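(* Let $1<p<\infty$ and let $\mu$ be any measure such that the real Banach space $L^p(\mu)$ is separable and infinite-dimensional. Let $\mathcal B$ be any collection of closed balls of $L^p(\mu)$, each of positive radius, such that every point of $L^p(\mu)$ belongs to some member of $\mathcal B$. Then $\mathcal B$ is not point-finite; that is, there exists a point of $L^p(\mu)$ that belongs to infinitely many members of $\mathcal B$.
   Context: A collection $\mathcal A$ of subsets of a Banach space $X$ is point-finite if every point of $X$ belongs to at most finitely many elements of $\mathcal A$. Balls are taken with respect to the usual $L^p$ norm. *)

theory Defs
  imports "HOL-Analysis.Analysis"
begin

section \<open>The real Banach space \<open>L\<^sup>p(M)\<close>\<close>

definition Lp_fun :: "'a measure \<Rightarrow> real \<Rightarrow> ('a \<Rightarrow> real) set" where
  "Lp_fun M p = {f \<in> borel_measurable M. integrable M (\<lambda>x. \<bar>f x\<bar> powr p)}"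

definition Lp_norm :: "'a measure \<Rightarrow> real \<Rightarrow> ('a \<Rightarrow> real) \<Rightarrow> real" where
  "Lp_norm M p f = (\<integral>x. \<bar>f x\<bar> powr p \<partial>M) powr (1 / p)"

definition Lp_rel :: "'a measure \<Rightarrow> real \<Rightarrow> (('a \<Rightarrow> real) \<times> ('a \<Rightarrow> real)) set" where
  "Lp_rel M p = {(f, g). f \<in> Lp_fun M p \<and> g \<in> Lp_fun M p \<and> (AE x in M. f x = g x)}"

definition Lp_class :: "'a measure \<Rightarrow> real \<Rightarrow> ('a \<Rightarrow> real) \<Rightarrow> ('a \<Rightarrow> real) set" where
  "Lp_class M p f = Lp_rel M p `` {f}"

definition Lp_space :: "'a measure \<Rightarrow> real \<Rightarrow> ('a \<Rightarrow> real) set set" where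
  "Lp_space M p = Lp_fun M p // Lp_rel M p"

text \<open>The distance of two classes is computed on representatives; it does not depend on their
  choice by \<open>Lp_dist_class\<close> below.\<close>

definition Lp_dist :: "'a measure \<Rightarrow> real \<Rightarrow> ('a \<Rightarrow> real) set \<Rightarrow> ('a \<Rightarrow> real) set \<Rightarrow> real" where
  "Lp_dist M p F G = Lp_norm M p (\<lambda>x. (SOME f. f \<in> F) x - (SOME g. g \<in> G) x)"

abbreviation Lp_topology :: "'a measure \<Rightarrow> real \<Rightarrow> ('a \<Rightarrow> real) set topology" where
  "Lp_topology M p \<equiv> Metric_space.mtopology (Lp_space M p) (Lp_dist M p)"

abbreviation Lp_cball :: "'a measure \<Rightarrow> real \<Rightarrow> ('a \<Rightarrow> real) set \<Rightarrow> real \<Rightarrow> ('a \<Rightarrow> real) set set" where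
  "Lp_cball M p \<equiv> Metric_space.mcball (Lp_space M p) (Lp_dist M p)"

text \<open>A finite spanning set is given by representatives \<open>b\<close>: the class of
  \<open>\<Sum>b\<in>B. c b * b\<close> is the linear combination of the classes of the \<open>b\<close>.\<close>

definition Lp_finite_dimensional :: "'a measure \<Rightarrow> real \<Rightarrow> bool" where
  "Lp_finite_dimensional M p \<longleftrightarrow>
     (\<exists>B. finite B \<and> B \<subseteq> Lp_fun M p \<and>
        Lp_space M p = {Lp_class M p (\<lambda>x. \<Sum>b\<in>B. c b * b x) | c :: ('a \<Rightarrow> real) \<Rightarrow> real. True})"

definition point_finite_on :: "'a set \<Rightarrow> 'a set set \<Rightarrow> bool" where
  "point_finite_on X \<A> \<longleftrightarrow> (\<forall>x\<in>X. finite {A \<in> \<A>. x \<in> A})"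


section \<open>Well-definedness\<close>

lemma equiv_Lp_rel: "equiv (Lp_fun M p) (Lp_rel M p)"
proof (rule equivI)
  show "trans (Lp_rel M p)"
    unfolding trans_def Lp_rel_def by auto
qed (auto simp: refl_on_def sym_def Lp_rel_def elim: eventually_mono)

lemma powr_convex_combination:
  fixes p t x y :: real
  assumes "1 \<le> p" "0 < t" "t < 1" "0 \<le> x" "0 \<le> y"
  shows "((1 - t) * x + t * y) powr p \<le> (1 - t) * x powr p + t * y powr p"
proof -
  have le: "s powr p \<le> s" if "0 < s" "s < 1" for s :: real
    using powr_mono'[of 1 p s] that assms by simp
  consider "x = 0" | "y = 0" | "x > 0" "y > 0" using assms by linarith
  then show ?thesis
  proof cases
    case 1
    have "(t * y) powr p \<le> t * y powr p"
      using assms le[of t] by (simp add: powr_mult mult_right_mono)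
    with 1 show ?thesis using assms by simp
  next
    case 2
    have "((1 - t) * x) powr p \<le> (1 - t) * x powr p"
      using assms le[of "1 - t"] by (simp add: powr_mult mult_right_mono)
    with 2 show ?thesis using assms by simp
  next
    case 3
    then show ?thesis
      using convex_onD[OF powr_convex[OF assms(1)], of t x y] assms by simp
  qed
qed

lemma powr_sum_le:
  fixes p a b u v :: real
  assumes "1 \<le> p" "0 < a" "0 < b"
  shows "\<bar>u + v\<bar> powr p \<le>
    (a + b) powr p * (a / (a + b) * (\<bar>u\<bar> powr p / a powr p) + b / (a + b) * (\<bar>v\<bar> powr p / b powr p))"
proof -
  define t where "t = b / (a + b)"
  have t: "0 < t" "t < 1" "1 - t = a / (a + b)"
    using assms by (auto simp: t_def field_simps)
  have "\<bar>u + v\<bar> powr p \<le> (\<bar>u\<bar> + \<bar>v\<bar>) powr p"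
    using assms by (intro powr_mono2) auto
  also have "\<bar>u\<bar> + \<bar>v\<bar> = (a + b) * ((1 - t) * (\<bar>u\<bar> / a) + t * (\<bar>v\<bar> / b))"
    using assms unfolding t(3) unfolding t_def
    by (simp add: distrib_left add_pos_pos[THEN less_imp_neq, symmetric])
  also have "\<dots> powr p = (a + b) powr p * ((1 - t) * (\<bar>u\<bar> / a) + t * (\<bar>v\<bar> / b)) powr p"
    by (rule powr_mult)
  also have "\<dots> \<le> (a + b) powr p * ((1 - t) * (\<bar>u\<bar> / a) powr p + t * (\<bar>v\<bar> / b) powr p)"
    using assms t by (intro mult_left_mono powr_convex_combination) auto
  finally show ?thesis
    unfolding t(3) unfolding t_def using assms by (simp add: powr_divide)
qed

lemma Lp_fun_add:
  assumes "1 \<le> p" "f \<in> Lp_fun M p" "g \<in> Lp_fun M p"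
  shows "(\<lambda>x. f x + g x) \<in> Lp_fun M p"
proof -
  have [measurable]: "f \<in> borel_measurable M" "g \<in> borel_measurable M"
    and i: "integrable M (\<lambda>x. \<bar>f x\<bar> powr p)" "integrable M (\<lambda>x. \<bar>g x\<bar> powr p)"
    using assms by (auto simp: Lp_fun_def)
  have "integrable M (\<lambda>x. \<bar>f x + g x\<bar> powr p)"
  proof (rule Bochner_Integration.integrable_bound)
    show "integrable M (\<lambda>x. 2 powr p * (1 / 2 * \<bar>f x\<bar> powr p + 1 / 2 * \<bar>g x\<bar> powr p))"
      using i by auto
    show "AE x in M. norm (\<bar>f x + g x\<bar> powr p)
        \<le> norm (2 powr p * (1 / 2 * \<bar>f x\<bar> powr p + 1 / 2 * \<bar>g x\<bar> powr p))"
      using powr_sum_le[OF assms(1), of 1 1] by (intro AE_I2) simp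
  qed measurable
  then show ?thesis by (simp add: Lp_fun_def)
qed

lemma Lp_fun_scale:
  assumes "f \<in> Lp_fun M p"
  shows "(\<lambda>x. c * f x) \<in> Lp_fun M p"
  using assms by (auto simp: Lp_fun_def abs_mult powr_mult)

lemma Lp_fun_diff:
  assumes "1 \<le> p" "f \<in> Lp_fun M p" "g \<in> Lp_fun M p"
  shows "(\<lambda>x. f x - g x) \<in> Lp_fun M p"
  using Lp_fun_add[OF assms(1,2) Lp_fun_scale[OF assms(3), of "-1"]] by simp

lemma Lp_fun_sum:
  assumes "1 \<le> p" "B \<subseteq> Lp_fun M p"
  shows "(\<lambda>x. \<Sum>b\<in>B. c b * b x) \<in> Lp_fun M p"
proof -
  have zero: "(\<lambda>x. 0) \<in> Lp_fun M p"
    by (simp add: Lp_fun_def)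
  show ?thesis
  proof (cases "finite B")
    case True
    then show ?thesis using assms(2)
      by (induction B rule: finite_induct)
        (auto simp: zero intro!: Lp_fun_add[OF assms(1)] Lp_fun_scale)
  qed (simp add: zero)
qed

lemma Lp_norm_eq_0_iff:
  assumes "f \<in> Lp_fun M p"
  shows "Lp_norm M p f = 0 \<longleftrightarrow> (AE x in M. f x = 0)"
  using assms integral_nonneg_eq_0_iff_AE[of M "\<lambda>x. \<bar>f x\<bar> powr p"]
  by (simp add: Lp_norm_def Lp_fun_def)

lemma Lp_norm_cong_AE:
  assumes "f \<in> Lp_fun M p" "g \<in> Lp_fun M p" "AE x in M. f x = g x"
  shows "Lp_norm M p f = Lp_norm M p g"
proof -
  have [measurable]: "f \<in> borel_measurable M" "g \<in> borel_measurable M"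
    using assms by (auto simp: Lp_fun_def)
  have "(\<integral>x. \<bar>f x\<bar> powr p \<partial>M) = (\<integral>x. \<bar>g x\<bar> powr p \<partial>M)"
    using assms(3) by (intro integral_cong_AE) auto
  then show ?thesis by (simp add: Lp_norm_def)
qed

lemma Lp_norm_triangle:
  assumes p: "1 \<le> p" and f: "f \<in> Lp_fun M p" and g: "g \<in> Lp_fun M p"
  shows "Lp_norm M p (\<lambda>x. f x + g x) \<le> Lp_norm M p f + Lp_norm M p g"
proof -
  have fg: "(\<lambda>x. f x + g x) \<in> Lp_fun M p"
    by (rule Lp_fun_add[OF p f g])
  have nonneg: "Lp_norm M p h \<ge> 0" for h :: "'a \<Rightarrow> real"
    by (simp add: Lp_norm_def)
  have norm_powr: "Lp_norm M p h powr p = (\<integral>x. \<bar>h x\<bar> powr p \<partial>M)" for h :: "'a \<Rightarrow> real"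
    using p by (simp add: Lp_norm_def powr_powr)
  consider "Lp_norm M p f = 0" | "Lp_norm M p g = 0" | "Lp_norm M p f > 0" "Lp_norm M p g > 0"
    using nonneg[of f] nonneg[of g] by linarith
  then show ?thesis
  proof cases
    case 1
    then have "AE x in M. f x + g x = g x"
      using Lp_norm_eq_0_iff[OF f] by auto
    with 1 show ?thesis using Lp_norm_cong_AE[OF fg g] by simp
  next
    case 2
    then have "AE x in M. f x + g x = f x"
      using Lp_norm_eq_0_iff[OF g] by auto
    with 2 show ?thesis using Lp_norm_cong_AE[OF fg f] by simp
  next
    case 3
    define a where "a = Lp_norm M p f"
    define b where "b = Lp_norm M p g"
    have ab: "a > 0" "b > 0" using 3 by (auto simp: a_def b_def)
    have i: "integrable M (\<lambda>x. \<bar>f x\<bar> powr p)" "integrable M (\<lambda>x. \<bar>g x\<bar> powr p)"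
      "integrable M (\<lambda>x. \<bar>f x + g x\<bar> powr p)"
      using f g fg by (auto simp: Lp_fun_def)
    have eq: "(\<integral>x. \<bar>f x\<bar> powr p \<partial>M) = a powr p" "(\<integral>x. \<bar>g x\<bar> powr p \<partial>M) = b powr p"
      by (simp_all add: a_def b_def norm_powr)
    have "(\<integral>x. \<bar>f x + g x\<bar> powr p \<partial>M) \<le> (\<integral>x. (a + b) powr p *
        (a / (a + b) * (\<bar>f x\<bar> powr p / a powr p) + b / (a + b) * (\<bar>g x\<bar> powr p / b powr p)) \<partial>M)"
      using i by (intro integral_mono powr_sum_le p ab) auto
    also have "\<dots> = (a + b) powr p * (a / (a + b) * (a powr p / a powr p)
        + b / (a + b) * (b powr p / b powr p))"
      using i eq by simp
    also have "\<dots> = (a + b) powr p"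
      using ab by (simp add: add_divide_distrib[symmetric])
    finally have "Lp_norm M p (\<lambda>x. f x + g x) \<le> ((a + b) powr p) powr (1 / p)"
      unfolding Lp_norm_def using p by (intro powr_mono2) auto
    also have "\<dots> = a + b"
      using p ab by (simp add: powr_powr)
    finally show ?thesis by (simp add: a_def b_def)
  qed
qed

lemma Lp_dist_class:
  assumes p: "1 \<le> p" and f: "f \<in> Lp_fun M p" and g: "g \<in> Lp_fun M p"
  shows "Lp_dist M p (Lp_class M p f) (Lp_class M p g) = Lp_norm M p (\<lambda>x. f x - g x)"
proof -
  have *: "(SOME k. k \<in> Lp_class M p h) \<in> Lp_class M p h" if "h \<in> Lp_fun M p" for h
    by (rule someI[of _ h]) (use that in \<open>simp add: Lp_class_def Lp_rel_def\<close>)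
  define f' where "f' = (SOME k. k \<in> Lp_class M p f)"
  define g' where "g' = (SOME k. k \<in> Lp_class M p g)"
  have f': "f' \<in> Lp_fun M p" "AE x in M. f x = f' x"
    and g': "g' \<in> Lp_fun M p" "AE x in M. g x = g' x"
    using *[OF f] *[OF g] by (auto simp: f'_def g'_def Lp_class_def Lp_rel_def)
  have "AE x in M. f' x - g' x = f x - g x"
    using f'(2) g'(2) by auto
  then have "Lp_norm M p (\<lambda>x. f' x - g' x) = Lp_norm M p (\<lambda>x. f x - g x)"
    by (intro Lp_norm_cong_AE Lp_fun_diff p f g f' g')
  then show ?thesis
    by (simp add: Lp_dist_def f'_def g'_def)
qed

lemma Metric_space_Lp:
  assumes p: "1 \<le> p"
  shows "Metric_space (Lp_space M p) (Lp_dist M p)"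
proof
  fix F G :: "('a \<Rightarrow> real) set"
  show "0 \<le> Lp_dist M p F G"
    by (simp add: Lp_dist_def Lp_norm_def)
  show "Lp_dist M p F G = Lp_dist M p G F"
    by (simp add: Lp_dist_def Lp_norm_def abs_minus_commute)
next
  fix F G
  assume "F \<in> Lp_space M p" "G \<in> Lp_space M p"
  then obtain f g where f: "f \<in> Lp_fun M p" "F = Lp_class M p f"
    and g: "g \<in> Lp_fun M p" "G = Lp_class M p g"
    by (auto simp: Lp_space_def Lp_class_def elim!: quotientE)
  have "Lp_dist M p F G = 0 \<longleftrightarrow> (AE x in M. f x - g x = 0)"
    using Lp_norm_eq_0_iff[OF Lp_fun_diff[OF p f(1) g(1)]] Lp_dist_class[OF p f(1) g(1)] f g by simp
  also have "\<dots> \<longleftrightarrow> (f, g) \<in> Lp_rel M p"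
    using f g by (simp add: Lp_rel_def)
  also have "\<dots> \<longleftrightarrow> F = G"
    using eq_equiv_class_iff[OF equiv_Lp_rel f(1) g(1)] f g by (simp add: Lp_class_def)
  finally show "Lp_dist M p F G = 0 \<longleftrightarrow> F = G" .
next
  fix F G H
  assume "F \<in> Lp_space M p" "G \<in> Lp_space M p" "H \<in> Lp_space M p"
  then obtain f g h where f: "f \<in> Lp_fun M p" "F = Lp_class M p f"
    and g: "g \<in> Lp_fun M p" "G = Lp_class M p g"
    and h: "h \<in> Lp_fun M p" "H = Lp_class M p h"
    by (auto simp: Lp_space_def Lp_class_def elim!: quotientE)
  show "Lp_dist M p F H \<le> Lp_dist M p F G + Lp_dist M p G H"
    using Lp_norm_triangle[OF p Lp_fun_diff[OF p f(1) g(1)] Lp_fun_diff[OF p g(1) h(1)]]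
      Lp_dist_class[OF p f(1) g(1)] Lp_dist_class[OF p g(1) h(1)] Lp_dist_class[OF p f(1) h(1)] f g h
    by simp
qed

end

theory Submission
  imports Defs
begin

text \<open>Enumerate the balls as \<open>B\<^sub>i\<close> with centres \<open>c\<^sub>i\<close> and radii \<open>r\<^sub>i\<close>, suppose that the covering is
  point-finite, and let \<open>g x\<close> be the maximum of \<open>r\<^sub>i\<^sup>p - \<parallel>x - c\<^sub>i\<parallel>\<^sup>p\<close>, which is nonnegative because the
  balls cover. Uniform smoothness bounds the radii of the balls near any given point, so \<open>g\<close> is
  locally Lipschitz and, near a point where it is positive, is a maximum over finitely many balls.
  There, adding \<open>a v\<close>, where \<open>v\<close> is a unit vector supported far out in a disjoint sequence, lowers
  \<open>g\<close> by almost \<open>a\<^sup>p\<close>, and at the same time increases the distance to any prescribed point. Repeating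
  such moves leads from \<open>x\<close> to a zero of \<open>g\<close> at distance at most a multiple of \<open>(g x) powr (1 / p)\<close>,
  without coming closer to a prescribed centre. By Baire, some relatively open part of the zero set
  of \<open>g\<close> lies in one ball \<open>B\<^sub>i\<close>. A point just outside \<open>B\<^sub>i\<close> near this part can be moved to a zero of
  \<open>g\<close> in this part while staying outside \<open>B\<^sub>i\<close>: a contradiction.\<close>

section \<open>Point-finite coverings by balls in complete metric spaces\<close>

lemma powr_diff_le:
  fixes s t p :: real
  assumes "1 \<le> p" "0 \<le> s" "0 \<le> t" "t \<le> R"
  shows "t powr p - s powr p \<le> p * R powr (p - 1) * \<bar>t - s\<bar>"
proof (cases "s < t")
  case False
  then have "t powr p \<le> s powr p" using assms by (intro powr_mono2) auto
  then show ?thesis using assms by (smt (verit) mult_nonneg_nonneg powr_ge_zero)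
next
  case True
  show ?thesis
  proof (cases "s = 0")
    case s0: True
    have "t powr p = t powr (p - 1) * t"
      using True assms powr_mult_base[of t "p - 1"] by (simp add: mult.commute)
    also have "\<dots> \<le> R powr (p - 1) * t"
      using assms by (intro mult_right_mono powr_mono2) auto
    also have "\<dots> \<le> p * (R powr (p - 1) * t)"
      using assms mult_right_mono[of 1 p "R powr (p - 1) * t"] by simp
    finally show ?thesis using assms s0 by (simp add: mult.assoc)
  next
    case False
    then have "\<exists>z>s. z < t \<and> t powr p - s powr p = (t - s) * (p * z powr (p - 1))"
      using True assms by (intro MVT2) (auto intro!: has_real_derivative_powr)
    then obtain z where z: "s < z" "z < t" "t powr p - s powr p = (t - s) * (p * z powr (p - 1))"
      by metis
    have "(t - s) * (p * z powr (p - 1)) \<le> (t - s) * (p * R powr (p - 1))"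
      using assms z by (intro mult_left_mono powr_mono2) auto
    then show ?thesis using z by (simp add: mult.commute)
  qed
qed

text \<open>\<open>T j a x\<close> stands for \<open>x + a v\<^sub>j\<close>, where the unit vectors \<open>v\<^sub>j\<close> have disjoint supports and hence are
  asymptotically \<open>p\<close>-orthogonal to every vector. The assumption \<open>flat\<close>, with \<open>z''\<close> the reflection of
  \<open>z'\<close> in \<open>z\<close>, expresses that spheres of large radius look like hyperplanes.\<close>

locale far_metric = Metric_space M d for M :: "'a set" and d +
  fixes p :: real and T :: "nat \<Rightarrow> real \<Rightarrow> 'a \<Rightarrow> 'a"
  assumes p_ge_1: "1 \<le> p"
    and complete: mcomplete
    and T_in: "x \<in> M \<Longrightarrow> T j a x \<in> M"
    and T_isometry: "x \<in> M \<Longrightarrow> y \<in> M \<Longrightarrow> d (T j a x) (T j a y) = d x y"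
    and T_far: "x \<in> M \<Longrightarrow> y \<in> M \<Longrightarrow> 0 < a \<Longrightarrow>
      (\<lambda>j. d (T j a x) y powr p) \<longlonglongrightarrow> d x y powr p + a powr p"
    and flat: "z \<in> M \<Longrightarrow> z' \<in> M \<Longrightarrow> 0 < \<epsilon> \<Longrightarrow>
      \<exists>z''\<in>M. \<exists>K. \<forall>c\<in>M. K \<le> d z c \<longrightarrow> d z' c + d z'' c \<le> 2 * d z c + \<epsilon>"
    and inward: "z \<in> M \<Longrightarrow> c \<in> M \<Longrightarrow> 0 < r \<Longrightarrow> r \<le> d z c \<Longrightarrow> 0 < \<epsilon> \<Longrightarrow>
      \<exists>z'\<in>M. d z' c < r \<and> d z z' < d z c - r + \<epsilon>"
begin

lemma T_near:
  assumes "x \<in> M" "0 < a"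
  shows "\<forall>\<^sub>F j in sequentially. d (T j a x) x < 2 * a"
proof -
  have "(\<lambda>j. d (T j a x) x powr p) \<longlonglongrightarrow> a powr p"
    using T_far[of x x a] assms p_ge_1 by simp
  moreover have "a powr p < (2 * a) powr p"
    using assms p_ge_1 by (intro powr_less_mono2) auto
  ultimately have "\<forall>\<^sub>F j in sequentially. d (T j a x) x powr p < (2 * a) powr p"
    by (rule order_tendstoD)
  then show ?thesis
  proof eventually_elim
    case (elim j)
    show ?case
    proof (rule ccontr)
      assume "\<not> d (T j a x) x < 2 * a"
      then have "(2 * a) powr p \<le> d (T j a x) x powr p"
        using assms p_ge_1 by (intro powr_mono2) auto
      with elim show False by simp
    qed
  qed
qed

end

section \<open>Point-finite coverings by indexed balls\<close>

locale ball_cover = far_metric M d p T for M :: "'a set" and d p T +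
  fixes J :: "'i set" and c :: "'i \<Rightarrow> 'a" and r :: "'i \<Rightarrow> real"
  assumes countable: "countable J"
    and centre: "i \<in> J \<Longrightarrow> c i \<in> M"
    and radius: "i \<in> J \<Longrightarrow> 0 < r i"
    and cover: "x \<in> M \<Longrightarrow> \<exists>i\<in>J. d (c i) x \<le> r i"
    and finite_at: "x \<in> M \<Longrightarrow> finite {i \<in> J. d (c i) x \<le> r i}"
begin

text \<open>The sequence \<open>i\<close> may repeat indices. Only finitely many balls contain
  \<open>x\<close>, and each of them, having one fixed radius, can occur as \<open>i k\<close> only
  for the finitely many \<open>k\<close> below that radius.\<close>

lemma unbounded_radii_escape:
  fixes i :: "nat \<Rightarrow> 'i"
  assumes i: "\<And>k. i k \<in> J" and r: "\<And>k. real k < r (i k)" and x: "x \<in> M"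
  shows "\<forall>\<^sub>F k in sequentially. r (i k) < d (c (i k)) x"
proof -
  have "{k. \<not> r (i k) < d (c (i k)) x} \<subseteq> (\<Union>j\<in>{j \<in> J. d (c j) x \<le> r j}. {k. real k < r j})"
    using i r by (auto simp: not_less)
  moreover have "finite {k::nat. real k < b}" for b
    by (rule finite_subset[of _ "{..nat \<lceil>b\<rceil>}"]) (auto, linarith)
  ultimately have "finite {k. \<not> r (i k) < d (c (i k)) x}"
    using finite_at[OF x] by (auto intro: finite_subset)
  then show ?thesis
    by (simp add: eventually_cofinite flip: cofinite_eq_sequentially)
qed

text \<open>Huge balls coming close to a point look like half-spaces: by flatness they would come close
  to every point, so that by Baire some point would lie in infinitely many of them.\<close>

lemma radii_locally_bounded:
  assumes z: "z \<in> M"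
  obtains \<rho> K where "\<rho> > 0"
    "\<And>i y. i \<in> J \<Longrightarrow> y \<in> M \<Longrightarrow> d z y < \<rho> \<Longrightarrow> d (c i) y \<le> r i \<Longrightarrow> r i \<le> K"
proof (rule ccontr)
  assume neg: "\<not> thesis"
  have "\<exists>i y. i \<in> J \<and> y \<in> M \<and> d z y < 1 / (real k + 1) \<and> d (c i) y \<le> r i \<and> real k < r i" for k :: nat
  proof (rule ccontr)
    assume "\<not> ?thesis"
    with that[of "1 / (real k + 1)" "real k"] neg show False by force
  qed
  then obtain i y where iy: "i k \<in> J" "y k \<in> M" "d z (y k) < 1 / (real k + 1)"
      "d (c (i k)) (y k) \<le> r (i k)" and big: "real k < r (i k)" for k :: nat
    by metis
  note esc = unbounded_radii_escape[of i, OF iy(1) big]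
  have near: "d z (c (i k)) < r (i k) + 1 / (real k + 1)" for k
    using triangle[of z "y k" "c (i k)"] iy[of k] centre[OF iy(1)] z commute[of "y k"] by fastforce
  \<comment> \<open>Here \<open>w\<close> plays the reflection of \<open>x\<close> in
    \<open>z\<close>. Eventually \<open>w\<close> and \<open>z\<close> lie outside the ball, so
    \<open>d z (c (i k))\<close> exceeds \<open>K\<close> and \<open>d w (c (i k))\<close> exceeds
    the radius. By \<open>near\<close>, \<open>d z (c (i k))\<close> exceeds the radius by less than
    \<epsilon> / 4, so flatness leaves for \<open>x\<close> less than the radius plus
    \<epsilon>.\<close>
  have lim: "\<forall>\<^sub>F k in sequentially. d x (c (i k)) < r (i k) + \<epsilon>" if x: "x \<in> M" and "0 < \<epsilon>" for x \<epsilon>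
  proof -
    obtain w K where w: "w \<in> M"
      and K: "\<And>c. c \<in> M \<Longrightarrow> K \<le> d z c \<Longrightarrow> d x c + d w c \<le> 2 * d z c + \<epsilon> / 2"
      using flat[OF z x, of "\<epsilon> / 2"] \<open>0 < \<epsilon>\<close> by auto
    have "(\<lambda>k. 1 / (real k + 1)) \<longlonglongrightarrow> 0"
      using LIMSEQ_inverse_real_of_nat by (simp add: inverse_eq_divide add.commute)
    then have "\<forall>\<^sub>F k in sequentially. 1 / (real k + 1) < \<epsilon> / 4"
      using \<open>0 < \<epsilon>\<close> by (intro order_tendstoD) auto
    moreover have "\<forall>\<^sub>F k in sequentially. K \<le> real k"
      using eventually_ge_at_top[of "nat \<lceil>K\<rceil>"] by eventually_elim linarith
    ultimately show ?thesis
      using esc[OF w] esc[OF z]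
    proof eventually_elim
      case (elim k)
      then have "d x (c (i k)) + d w (c (i k)) \<le> 2 * d z (c (i k)) + \<epsilon> / 2"
        using big[of k] by (intro K centre iy) (simp add: commute)
      then show ?case using elim near[of k] by (simp add: commute)
    qed
  qed
  \<comment> \<open>Each \<open>U m\<close> is open and, by \<open>lim\<close> and
    \<open>inward\<close>, dense. A point of all \<open>U m\<close> lies in the ball
    \<open>i k\<close> for arbitrarily large \<open>k\<close>, which \<open>esc\<close>
    forbids.\<close>
  define U where "U m = {x \<in> M. \<exists>k\<ge>m. d x (c (i k)) < r (i k)}" for m :: nat
  have "mtopology closure_of \<Inter>(range U) = M"
  proof (rule metric_Baire_category[OF complete])
    fix S assume "S \<in> range U"
    then obtain m where S: "S = U m" by auto
    have "U m = (\<Union>k\<in>{m..}. mball (c (i k)) (r (i k)))"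
      using centre[OF iy(1)] by (auto simp: U_def commute)
    then have "openin mtopology (U m)" by auto
    moreover have "\<exists>y\<in>U m. y \<in> mball x \<epsilon>" if x: "x \<in> M" "0 < \<epsilon>" for x \<epsilon>
    proof -
      have "\<forall>\<^sub>F k in sequentially. m \<le> k \<and> d x (c (i k)) < r (i k) + \<epsilon> / 2"
        using lim[of x "\<epsilon> / 2"] x eventually_ge_at_top[of m] by (auto intro: eventually_conj)
      then obtain k where k: "m \<le> k" "d x (c (i k)) < r (i k) + \<epsilon> / 2"
        by (auto simp: eventually_sequentially)
      show ?thesis
      proof (cases "d x (c (i k)) < r (i k)")
        case True
        then show ?thesis using x k by (intro bexI[of _ x]) (auto simp: U_def)
      next
        case False
        then obtain y where "y \<in> M" "d y (c (i k)) < r (i k)" "d x y < d x (c (i k)) - r (i k) + \<epsilon> / 2"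
          using inward[of x "c (i k)" "r (i k)" "\<epsilon> / 2"] x centre[OF iy(1)] radius[OF iy(1)]
          by (auto simp: not_less)
        then show ?thesis using x k by (intro bexI[of _ y]) (auto simp: U_def)
      qed
    qed
    then have "mtopology closure_of (U m) = M"
      by (auto simp: metric_closure_of)
    ultimately show "openin mtopology S \<and> mtopology closure_of S = M"
      by (simp add: S)
  qed simp
  then have "\<Inter>(range U) \<noteq> {}"
    using z by auto
  then obtain x where x: "\<And>m. x \<in> U m" by auto
  then have "x \<in> M" by (auto simp: U_def)
  from esc[OF this] obtain m where m: "\<And>k. k \<ge> m \<Longrightarrow> r (i k) < d (c (i k)) x"
    by (auto simp: eventually_sequentially)
  from x[of m] obtain k where "k \<ge> m" "d x (c (i k)) < r (i k)" by (auto simp: U_def)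
  with m[of k] show False by (simp add: commute)
qed

section \<open>The depth of a point in the covering\<close>

text \<open>For \<open>p = 2\<close> this is minus the power of \<open>x\<close> with respect to the
  sphere. With \<open>p\<close>-th powers, a far move of length \<open>a\<close> lowers the depth in
  every ball by asymptotically the same amount \<open>a powr p\<close>.\<close>

definition depth :: "'i \<Rightarrow> 'a \<Rightarrow> real" where
  "depth i x = r i powr p - d (c i) x powr p"

text \<open>For a point of the space the maximum runs over a finite nonempty set of balls; all other
  balls have negative depth, so it is the maximum over all of \<open>J\<close>.\<close>

definition cover_depth :: "'a \<Rightarrow> real" where
  "cover_depth x = Max ((\<lambda>i. depth i x) ` {i \<in> J. d (c i) x \<le> r i})"

lemma depth_nonneg_iff: "i \<in> J \<Longrightarrow> 0 \<le> depth i x \<longleftrightarrow> d (c i) x \<le> r i"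
proof
  assume i: "i \<in> J" and "0 \<le> depth i x"
  then show "d (c i) x \<le> r i"
    using powr_less_mono2[of p "r i" "d (c i) x"] p_ge_1 radius[OF i] by (force simp: depth_def)
next
  assume "i \<in> J" "d (c i) x \<le> r i"
  then show "0 \<le> depth i x"
    using p_ge_1 by (auto simp: depth_def intro: powr_mono2)
qed

lemma cover_depth_attained:
  assumes "x \<in> M"
  obtains i where "i \<in> J" "d (c i) x \<le> r i" "cover_depth x = depth i x"
proof -
  have "cover_depth x \<in> (\<lambda>i. depth i x) ` {i \<in> J. d (c i) x \<le> r i}"
    unfolding cover_depth_def using finite_at[OF assms] cover[OF assms] by (intro Max_in) auto
  then show ?thesis using that by auto
qed

lemma cover_depth_nonneg: "x \<in> M \<Longrightarrow> 0 \<le> cover_depth x"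
  by (metis cover_depth_attained depth_nonneg_iff)

lemma depth_le_cover_depth:
  assumes "x \<in> M" "i \<in> J"
  shows "depth i x \<le> cover_depth x"
proof (cases "d (c i) x \<le> r i")
  case True
  then show ?thesis unfolding cover_depth_def
    using finite_at[OF assms(1)] assms by (intro Max_ge) auto
next
  case False
  then show ?thesis using depth_nonneg_iff[of i x] cover_depth_nonneg assms by fastforce
qed

text \<open>Locally bounded radii bound the distances involved, so \<open>powr_diff_le\<close>
  applies with one constant for all balls. Only \<open>y\<close> has to lie in the ball: this
  already bounds the radius, and \<open>x\<close> may be outside, where the depth is
  negative.\<close>

lemma depth_locally_lipschitz:
  assumes z: "z \<in> M"
  obtains \<rho> L where "\<rho> > 0" "L \<ge> 0"
    "\<And>i x y. i \<in> J \<Longrightarrow> x \<in> M \<Longrightarrow> y \<in> M \<Longrightarrow> d z x < \<rho> \<Longrightarrow> d z y < \<rho> \<Longrightarrow>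
      0 \<le> depth i y \<Longrightarrow> depth i y - depth i x \<le> L * d x y"
proof -
  obtain \<rho> K where \<rho>: "\<rho> > 0"
    and K: "\<And>i y. i \<in> J \<Longrightarrow> y \<in> M \<Longrightarrow> d z y < \<rho> \<Longrightarrow> d (c i) y \<le> r i \<Longrightarrow> r i \<le> K"
    using radii_locally_bounded[OF z] by metis
  define L where "L = p * (K + 2 * \<rho>) powr (p - 1)"
  have L: "L \<ge> 0" using p_ge_1 by (simp add: L_def)
  show ?thesis
  proof (rule that[OF \<rho> L])
    fix i x y
    assume *: "i \<in> J" "x \<in> M" "y \<in> M" "d z x < \<rho>" "d z y < \<rho>" "0 \<le> depth i y"
    have ci: "c i \<in> M" using * centre by auto
    have "d (c i) y \<le> K"
      using K[of i y] * by (auto simp: depth_nonneg_iff)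
    moreover have xy: "d x y \<le> 2 * \<rho>"
      using triangle[of x z y] * z commute[of x z] by auto
    ultimately have "d (c i) x \<le> K + 2 * \<rho>"
      using triangle[of "c i" y x] * ci commute[of x y] by auto
    then have "d (c i) x powr p - d (c i) y powr p \<le> L * \<bar>d (c i) x - d (c i) y\<bar>"
      unfolding L_def using p_ge_1 by (intro powr_diff_le) auto
    also have "\<dots> \<le> L * d x y"
      using triangle[of "c i" y x] triangle[of "c i" x y] * ci commute[of x y] L
      by (intro mult_left_mono) auto
    finally show "depth i y - depth i x \<le> L * d x y" by (simp add: depth_def)
  qed
qed

text \<open>A ball of largest depth at \<open>y\<close> bounds the cover depth at \<open>x\<close>
  from below even if \<open>x\<close> lies outside it, so the one-sided estimate for single balls
  suffices.\<close>

lemma cover_depth_locally_lipschitz: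
  assumes z: "z \<in> M"
  obtains \<rho> L where "\<rho> > 0" "L \<ge> 0"
    "\<And>x y. x \<in> M \<Longrightarrow> y \<in> M \<Longrightarrow> d z x < \<rho> \<Longrightarrow> d z y < \<rho> \<Longrightarrow>
      \<bar>cover_depth x - cover_depth y\<bar> \<le> L * d x y"
proof -
  obtain \<rho> L where \<rho>: "\<rho> > 0" "L \<ge> 0"
    and L: "\<And>i x y. i \<in> J \<Longrightarrow> x \<in> M \<Longrightarrow> y \<in> M \<Longrightarrow> d z x < \<rho> \<Longrightarrow> d z y < \<rho> \<Longrightarrow>
      0 \<le> depth i y \<Longrightarrow> depth i y - depth i x \<le> L * d x y"
    using depth_locally_lipschitz[OF z] by metis
  have le: "cover_depth y - cover_depth x \<le> L * d x y"
    if *: "x \<in> M" "y \<in> M" "d z x < \<rho>" "d z y < \<rho>" for x y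
  proof -
    obtain i where i: "i \<in> J" "d (c i) y \<le> r i" "cover_depth y = depth i y"
      using cover_depth_attained[OF *(2)] by metis
    then show ?thesis
      using L[of i x y] depth_le_cover_depth[of x i] depth_nonneg_iff[of i y] * by simp
  qed
  show ?thesis
    by (rule that[OF \<rho>]) (use le in \<open>fastforce simp: commute abs_le_iff\<close>)
qed

lemma cover_depth_tendsto:
  assumes x: "limitin mtopology x z sequentially"
  shows "(\<lambda>k. cover_depth (x k)) \<longlonglongrightarrow> cover_depth z"
proof -
  have z: "z \<in> M" using x by (simp add: limitin_mspace)
  obtain \<rho> L where \<rho>: "\<rho> > 0" "L \<ge> 0"
    and L: "\<And>x y. x \<in> M \<Longrightarrow> y \<in> M \<Longrightarrow> d z x < \<rho> \<Longrightarrow> d z y < \<rho> \<Longrightarrow>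
      \<bar>cover_depth x - cover_depth y\<bar> \<le> L * d x y"
    using cover_depth_locally_lipschitz[OF z] by metis
  have lim: "\<forall>\<^sub>F k in sequentially. x k \<in> M" "(\<lambda>k. d (x k) z) \<longlonglongrightarrow> 0"
    using x by (auto simp: limitin_metric_dist_null)
  have "\<forall>\<^sub>F k in sequentially. d (x k) z < \<rho>"
    using lim(2) \<rho> by (intro order_tendstoD) auto
  then have "\<forall>\<^sub>F k in sequentially. norm (cover_depth (x k) - cover_depth z) \<le> L * d (x k) z"
    using lim(1)
  proof eventually_elim
    case (elim k)
    then show ?case using L[of "x k" z] z \<rho> by (simp add: commute)
  qed
  moreover have "(\<lambda>k. L * d (x k) z) \<longlonglongrightarrow> 0"
    using tendsto_mult_left[OF lim(2), of L] by simp
  ultimately have "(\<lambda>k. cover_depth (x k) - cover_depth z) \<longlonglongrightarrow> 0"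
    by (rule Lim_null_comparison)
  then show ?thesis by (simp add: LIM_zero_iff)
qed

section \<open>Descent to the zeros of the cover depth\<close>

text \<open>In the finitely many balls that contain \<open>x\<close>, \<open>T_far\<close>
  eventually yields a drop of more than \<open>3 / 4 * a powr p\<close>, and for small
  \<open>a\<close> no other ball can attain the new maximum. The factor 3/4 lies below the
  asymptotic rate 1 and leaves a margin over the rate 1/2 of the greedy choice below.\<close>

lemma descent:
  assumes x: "x \<in> M" and pos: "0 < cover_depth x"
  obtains b where "b > 0" "\<And>a. 0 < a \<Longrightarrow> a < b \<Longrightarrow>
    \<forall>\<^sub>F j in sequentially. cover_depth (T j a x) \<le> cover_depth x - 3 / 4 * a powr p"
proof -
  obtain \<rho> L where \<rho>: "\<rho> > 0" "L \<ge> 0"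
    and L: "\<And>i u v. i \<in> J \<Longrightarrow> u \<in> M \<Longrightarrow> v \<in> M \<Longrightarrow> d x u < \<rho> \<Longrightarrow> d x v < \<rho> \<Longrightarrow>
      0 \<le> depth i v \<Longrightarrow> depth i v - depth i u \<le> L * d u v"
    using depth_locally_lipschitz[OF x] by metis
  \<comment> \<open>The first bound keeps the moved point in the Lipschitz neighbourhood; the second
    makes two Lipschitz errors of at most \<open>2 * (L * b)\<close> each smaller than the cover
    depth at \<open>x\<close>.\<close>
  define b where "b = min (\<rho> / 2) (cover_depth x / (4 * (L + 1)))"
  have b: "b > 0" using \<rho> pos by (simp add: b_def)
  have b2: "2 * b \<le> \<rho>" "4 * L * b < cover_depth x"
  proof -
    have "4 * (L + 1) * b \<le> 4 * (L + 1) * (cover_depth x / (4 * (L + 1)))"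
      using \<rho> by (intro mult_left_mono) (auto simp: b_def)
    also have "\<dots> = cover_depth x" using \<rho> by simp
    finally show "4 * L * b < cover_depth x" using b by (simp add: algebra_simps)
  qed (simp add: b_def)
  show ?thesis
  proof (rule that[OF b])
    fix a assume a: "0 < a" "a < b"
    let ?I = "{i \<in> J. d (c i) x \<le> r i}"
    have "\<forall>\<^sub>F j in sequentially. d (T j a x) (c i) powr p > d x (c i) powr p + 3 / 4 * a powr p"
      if "i \<in> ?I" for i
      using T_far[of x "c i" a] x a centre that by (intro order_tendstoD) auto
    then have "\<forall>\<^sub>F j in sequentially. \<forall>i\<in>?I.
        d (T j a x) (c i) powr p > d x (c i) powr p + 3 / 4 * a powr p"
      using finite_at[OF x] by (intro eventually_ball_finite) auto
    then show "\<forall>\<^sub>F j in sequentially. cover_depth (T j a x) \<le> cover_depth x - 3 / 4 * a powr p"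
      using T_near[OF x a(1)]
    proof eventually_elim
      case (elim j)
      define y where "y = T j a x"
      have y: "y \<in> M" "d x y < 2 * a" "d x y < \<rho>"
        using elim(2) x a b2 by (auto simp: y_def T_in commute)
      have 4: "L * d x y \<le> 2 * (L * b)"
        using y a \<rho> mult_left_mono[of "d x y" "2 * b" L] by simp
      obtain i0 where i0: "i0 \<in> J" "d (c i0) x \<le> r i0" "cover_depth x = depth i0 x"
        using cover_depth_attained[OF x] by metis
      have 5: "cover_depth y \<ge> cover_depth x - 2 * (L * b)"
        using L[of i0 y x] i0 x y \<rho> depth_le_cover_depth[of y i0] depth_nonneg_iff[of i0 x] 4
        by (simp add: commute)
      obtain i where i: "i \<in> J" "d (c i) y \<le> r i" "cover_depth y = depth i y"
        using cover_depth_attained[OF y(1)] by metis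
      have "depth i y - depth i x \<le> L * d x y"
        using L[of i x y] i x y \<rho> depth_nonneg_iff[of i y] by simp
      \<comment> \<open>The ball that is deepest at \<open>y\<close> has depth at least
        \<open>cover_depth x - 4 * (L * b)\<close> at \<open>x\<close>, so it already contains
        \<open>x\<close>.\<close>
      then have "0 < depth i x" using 4 5 i(3) b2 by simp
      then have "i \<in> ?I" using i depth_nonneg_iff[of i x] by simp
      then have "depth i y \<le> depth i x - 3 / 4 * a powr p"
        using elim(1) by (force simp: depth_def y_def commute)
      then show ?case
        using i depth_le_cover_depth[OF x i(1)] by (simp add: y_def)
    qed
  qed
qed

text \<open>The greedy choice, in every step, of the essentially largest far move that still lowers the
  cover depth at half the asymptotic rate. The set \<open>H\<close> records the previous points; far moves are
  almost orthogonal to all of them, which makes the sequence converge.\<close>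

lemma reach_zero_cover_depth:
  assumes x0: "x0 \<in> M" and q: "q \<in> M"
  obtains z where "z \<in> M" "cover_depth z = 0" "d z x0 powr p \<le> 4 * cover_depth x0" "d x0 q \<le> d z q"
proof (rule ccontr)
  assume neg: "\<not> thesis"
  note found = that
  \<comment> \<open>Only dyadic lengths are tried, so that a largest admissible one exists: that of
    least exponent.\<close>
  define A where "A l = (1 / 2 :: real) ^ l" for l
  have A: "A l > 0" for l by (simp add: A_def)
  \<comment> \<open>Infinitely many \<open>j\<close> are enough, since the other requirements on a
    move hold for almost all \<open>j\<close>. Asking only for half the asymptotic rate lets
    admissibility pass from a limit point to nearby points.\<close>
  define P where "P x l \<longleftrightarrow>
    (\<exists>\<^sub>F j in sequentially. cover_depth (T j (A l) x) \<le> cover_depth x - A l powr p / 2)" for x l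
  have ex: "\<exists>b>0. \<forall>l. A l < b \<longrightarrow> (\<forall>\<^sub>F j in sequentially.
      cover_depth (T j (A l) x) \<le> cover_depth x - 3 / 4 * A l powr p)"
    if "x \<in> M" "0 < cover_depth x" for x
    by (rule descent[OF that]) (use A in blast)
  have exP: "\<exists>l. P x l" if x: "x \<in> M" "0 < cover_depth x" for x
  proof -
    obtain b where b: "b > 0" "\<And>l. A l < b \<Longrightarrow> (\<forall>\<^sub>F j in sequentially.
        cover_depth (T j (A l) x) \<le> cover_depth x - 3 / 4 * A l powr p)"
      using ex[OF x] by metis
    obtain l where "A l < b" using real_arch_pow_inv[of b "1 / 2"] b by (auto simp: A_def)
    from b(2)[OF this] have "\<forall>\<^sub>F j in sequentially. cover_depth (T j (A l) x) \<le> cover_depth x - A l powr p / 2"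
      by eventually_elim (use powr_ge_zero[of "A l" p] in linarith)
    then have "P x l" unfolding P_def by (intro eventually_frequently) auto
    then show ?thesis by blast
  qed
  \<comment> \<open>A state consists of the set of earlier points and the current point.\<close>
  define inv where "inv s \<longleftrightarrow> (case s of (H, x) \<Rightarrow> finite H \<and> H \<subseteq> M \<and> x \<in> M \<and> d x0 q \<le> d x q)"
    for s :: "'a set \<times> 'a"
  \<comment> \<open>At cover depth 0 no move is required, which keeps the recursion total. The
    factor 2 exceeds the asymptotic rate 1 of \<open>T_far\<close>, so the bound holds for almost
    all \<open>j\<close>, simultaneously for the finitely many recorded points.\<close>
  define step where "step s t \<longleftrightarrow> (case s of (H, x) \<Rightarrow> case t of (H', y) \<Rightarrow> H' = insert x H \<and>
      (0 < cover_depth x \<longrightarrow> (let a = A (LEAST l. P x l) powr p in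
         cover_depth y \<le> cover_depth x - a / 2 \<and>
         (\<forall>h\<in>H'. d y h powr p \<le> d x h powr p + 2 * a))))"
    for s t :: "'a set \<times> 'a"
  have "\<exists>f. \<forall>n. (inv (f n) \<and> (n = 0 \<longrightarrow> f n = ({}, x0))) \<and> step (f n) (f (Suc n))"
  proof (rule dependent_nat_choice)
    show "\<exists>s. inv s \<and> (0 = 0 \<longrightarrow> s = ({}, x0))"
      using x0 by (auto simp: inv_def)
    fix s :: "'a set \<times> 'a" and n :: nat
    assume "inv s \<and> (n = 0 \<longrightarrow> s = ({}, x0))"
    then obtain H x where s: "s = (H, x)" and H: "finite H" "H \<subseteq> M" "x \<in> M" "d x0 q \<le> d x q"
      by (cases s) (auto simp: inv_def)
    show "\<exists>t. (inv t \<and> (Suc n = 0 \<longrightarrow> t = ({}, x0))) \<and> step s t"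
    proof (cases "0 < cover_depth x")
      case False
      then show ?thesis using H by (intro exI[of _ "(insert x H, x)"]) (auto simp: s inv_def step_def)
    next
      case True
      define l where "l = (LEAST l. P x l)"
      have "P x l" unfolding l_def using exP[OF H(3) True] by (rule LeastI_ex)
      then have freq: "\<exists>\<^sub>F j in sequentially. cover_depth (T j (A l) x) \<le> cover_depth x - A l powr p / 2"
        by (simp add: P_def)
      have "\<forall>\<^sub>F j in sequentially. d (T j (A l) x) h powr p < d x h powr p + 2 * A l powr p"
        if "h \<in> insert x H" for h
      proof -
        have "h \<in> M" using H that by auto
        then show ?thesis
          using A[of l] by (intro order_tendstoD(2)[OF T_far[OF H(3)]]) auto
      qed
      then have "\<forall>\<^sub>F j in sequentially. \<forall>h\<in>insert x H.
          d (T j (A l) x) h powr p < d x h powr p + 2 * A l powr p"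
        using H by (intro eventually_ball_finite) auto
      moreover have "\<forall>\<^sub>F j in sequentially. d (T j (A l) x) q powr p > d x q powr p"
        using T_far[of x q "A l"] H A[of l] q by (intro order_tendstoD) auto
      ultimately have "\<forall>\<^sub>F j in sequentially. (\<forall>h\<in>insert x H.
          d (T j (A l) x) h powr p < d x h powr p + 2 * A l powr p) \<and> d (T j (A l) x) q powr p > d x q powr p"
        by eventually_elim auto
      then have "\<forall>\<^sub>F j in sequentially. cover_depth (T j (A l) x) \<le> cover_depth x - A l powr p / 2 \<longrightarrow>
          cover_depth (T j (A l) x) \<le> cover_depth x - A l powr p / 2 \<and> (\<forall>h\<in>insert x H.
          d (T j (A l) x) h powr p < d x h powr p + 2 * A l powr p) \<and> d (T j (A l) x) q powr p > d x q powr p"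
        by eventually_elim auto
      from frequently_ex[OF frequently_rev_mp[OF freq this]]
      obtain j where j: "cover_depth (T j (A l) x) \<le> cover_depth x - A l powr p / 2"
        "\<forall>h\<in>insert x H. d (T j (A l) x) h powr p < d x h powr p + 2 * A l powr p"
        "d (T j (A l) x) q powr p > d x q powr p"
        by blast
      have "d x q \<le> d (T j (A l) x) q"
        using j(3) powr_mono2[of p "d (T j (A l) x) q" "d x q"] p_ge_1 by force
      then show ?thesis using H j
        by (intro exI[of _ "(insert x H, T j (A l) x)"])
          (auto simp: s inv_def step_def T_in Let_def simp flip: l_def intro: less_imp_le)
    qed
  qed
  then obtain f where f: "\<And>n. inv (f n)" "f 0 = ({}, x0)" "\<And>n. step (f n) (f (Suc n))"
    by metis
  define X where "X n = snd (f n)" for n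
  have X0: "X 0 = x0" by (simp add: X_def f)
  have X: "X n \<in> M" "d x0 q \<le> d (X n) q" for n
    using f(1)[of n] by (auto simp: inv_def X_def split: prod.splits)
  have H: "m \<le> n \<Longrightarrow> X m \<in> fst (f (Suc n))" for m n
  proof (induction n)
    case 0
    then show ?case using f(3)[of 0] by (auto simp: step_def X_def split: prod.splits)
  next
    case (Suc n)
    then show ?case using f(3)[of "Suc n"]
      by (cases "m = Suc n") (auto simp: step_def X_def split: prod.splits)
  qed
  define a where "a n = A (LEAST l. P (X n) l) powr p" for n
  have st: "cover_depth (X (Suc n)) \<le> cover_depth (X n) - a n / 2 \<and>
      (\<forall>m\<le>n. d (X (Suc n)) (X m) powr p \<le> d (X n) (X m) powr p + 2 * a n)"
    if "0 < cover_depth (X n)" for n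
    using f(3)[of n] that H[of _ n]
    by (auto simp: step_def a_def Let_def X_def split: prod.splits)
  have a0: "a n \<ge> 0" for n by (simp add: a_def)
  \<comment> \<open>Each move adds at most \<open>2 * a n\<close> to the \<open>p\<close>-th power
    of the distance from \<open>X m\<close>, which starts at 0. So tails of the sum of
    \<open>a\<close>, the \<open>p\<close>-th powers of the lengths, control the distances; the
    lengths themselves need not be summable.\<close>
  have close: "(\<forall>m<n. 0 < cover_depth (X m)) \<Longrightarrow> m \<le> n \<Longrightarrow>
      d (X n) (X m) powr p \<le> 2 * sum a {m..<n} \<and> cover_depth (X n) \<le> cover_depth (X m) - sum a {m..<n} / 2" for m n
  proof (induction n)
    case 0
    then show ?case using X p_ge_1 by simp
  next
    case (Suc n)
    show ?case
    proof (cases "m = Suc n")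
      case True
      then show ?thesis using X p_ge_1 by simp
    next
      case False
      then have "m \<le> n" using Suc by simp
      then show ?thesis using Suc st[of n] by (force simp: add_divide_distrib)
    qed
  qed
  have no: "\<not> (cover_depth z = 0 \<and> d z x0 powr p \<le> 4 * cover_depth x0 \<and> d x0 q \<le> d z q)" if "z \<in> M" for z
    using neg found that by metis
  \<comment> \<open>At the first zero, \<open>X n\<close> would be the point sought: the drop of the
    cover depth bounds \<open>sum a {0..<n}\<close> by \<open>2 * cover_depth x0\<close>, hence the
    \<open>p\<close>-th power of the distance from \<open>x0\<close> by twice that.\<close>
  have pos: "0 < cover_depth (X n)" for n
  proof (induction n rule: less_induct)
    case (less n)
    have cl: "d (X n) (X 0) powr p \<le> 2 * sum a {0..<n}" "cover_depth (X n) \<le> cover_depth (X 0) - sum a {0..<n} / 2"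
      using close[of n 0] less by auto
    then have "d (X n) x0 powr p \<le> 4 * cover_depth x0"
      using cover_depth_nonneg[OF X(1)[of n]] by (simp add: X0)
    then have "cover_depth (X n) \<noteq> 0" using no[OF X(1)[of n]] X by auto
    then show ?case using cover_depth_nonneg[OF X(1)[of n]] by simp
  qed
  have sum_le: "sum a {0..<n} \<le> 2 * cover_depth x0" for n
    using close[of n 0] pos cover_depth_nonneg[OF X(1)[of n]] by (simp add: X0)
  have summ: "summable a"
  proof (rule bounded_imp_summable[OF a0])
    show "sum a {..n} \<le> 2 * cover_depth x0" for n
      using sum_le[of "Suc n"] by (simp only: atLeast0LessThan lessThan_Suc_atMost)
  qed
  have "MCauchy X"
    unfolding MCauchy_def
  proof (intro conjI allI impI)
    show "range X \<subseteq> M" using X by auto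
    fix \<epsilon> :: real assume "0 < \<epsilon>"
    then have "0 < \<epsilon> powr p / 2" by simp
    from summable_partial_sum_bound[OF summ this] obtain N
      where N: "\<And>m n. N \<le> m \<Longrightarrow> norm (sum a {m..n}) < \<epsilon> powr p / 2" by metis
    have *: "d (X n) (X m) < \<epsilon>" if "N \<le> m" "m \<le> n" for m n
    proof -
      have "sum a {m..<n} \<le> sum a {m..n}" using a0 by (intro sum_mono2) auto
      then have "d (X n) (X m) powr p < \<epsilon> powr p"
        using close[of n m] pos that N[of m n] by auto
      then show ?thesis
        using powr_mono2[of p \<epsilon> "d (X n) (X m)"] p_ge_1 \<open>0 < \<epsilon>\<close> by force
    qed
    show "\<exists>N. \<forall>n n'. N \<le> n \<longrightarrow> N \<le> n' \<longrightarrow> d (X n) (X n') < \<epsilon>"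
      by (rule exI[of _ N]) (metis * commute nle_le)
  qed
  then obtain z where z: "limitin mtopology X z sequentially"
    using complete by (auto simp: mcomplete_def)
  then have zM: "z \<in> M" and dz: "(\<lambda>k. d (X k) z) \<longlonglongrightarrow> 0"
    by (auto simp: limitin_metric_dist_null)
  have lim: "(\<lambda>k. d (X k) y) \<longlonglongrightarrow> d z y" if "y \<in> M" for y
  proof -
    have "norm (d (X k) y - d z y) \<le> d (X k) z" for k
      using triangle[of "X k" z y] triangle[of z "X k" y] X(1)[of k] zM that commute[of z "X k"] by auto
    then have "(\<lambda>k. d (X k) y - d z y) \<longlonglongrightarrow> 0"
      by (intro Lim_null_comparison[OF _ dz]) auto
    then show ?thesis by (simp add: LIM_zero_iff)
  qed
  have "d x0 q \<le> d z q"
    using X by (intro LIMSEQ_le_const[OF lim[OF q]]) auto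
  moreover have "d z x0 powr p \<le> 4 * cover_depth x0"
  proof (rule LIMSEQ_le_const2)
    show "(\<lambda>k. d (X k) x0 powr p) \<longlonglongrightarrow> d z x0 powr p"
      using lim[OF x0] p_ge_1 by (intro tendsto_powr2) auto
    show "\<exists>N. \<forall>n\<ge>N. d (X n) x0 powr p \<le> 4 * cover_depth x0"
    proof (intro exI allI impI)
      fix n show "d (X n) x0 powr p \<le> 4 * cover_depth x0"
        using close[of n 0] pos sum_le[of n] by (simp add: X0)
    qed
  qed
  ultimately have "cover_depth z \<noteq> 0" using no[OF zM] by auto
  \<comment> \<open>It remains to refute a limit of positive cover depth. A length admissible at
    \<open>z\<close> with rate 3/4 is admissible with rate 1/2 at all late \<open>X k\<close>, so
    the greedy lengths stay away from 0, against the summability of \<open>a\<close>.\<close>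
  then have gz: "0 < cover_depth z" using cover_depth_nonneg[OF zM] by simp
  obtain \<rho> L where \<rho>: "\<rho> > 0" "L \<ge> 0"
    and L: "\<And>x y. x \<in> M \<Longrightarrow> y \<in> M \<Longrightarrow> d z x < \<rho> \<Longrightarrow> d z y < \<rho> \<Longrightarrow>
      \<bar>cover_depth x - cover_depth y\<bar> \<le> L * d x y"
    using cover_depth_locally_lipschitz[OF zM] by metis
  obtain b where b: "b > 0" "\<And>l. A l < b \<Longrightarrow> (\<forall>\<^sub>F j in sequentially.
      cover_depth (T j (A l) z) \<le> cover_depth z - 3 / 4 * A l powr p)"
    using ex[OF zM gz] by metis
  obtain l where l: "A l < min b (\<rho> / 4)"
    using real_arch_pow_inv[of "min b (\<rho> / 4)" "1 / 2"] b \<rho> by (auto simp: A_def)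
  \<comment> \<open>Since moves are isometries, the drop at \<open>z\<close> carries over to
    \<open>X k\<close> at the cost of two Lipschitz errors \<open>L * d (X k) z\<close>; together
    they must stay below 3/4 - 1/2 = 1/4 of \<open>A l powr p\<close>.\<close>
  have "(\<lambda>k. 2 * L * d (X k) z) \<longlonglongrightarrow> 0"
    using tendsto_mult_left[OF dz, of "2 * L"] by simp
  then have "\<forall>\<^sub>F k in sequentially. 2 * L * d (X k) z < A l powr p / 4"
    using A[of l] by (intro order_tendstoD) auto
  moreover have "\<forall>\<^sub>F k in sequentially. d (X k) z < \<rho> / 2"
    using dz \<rho> by (intro order_tendstoD) auto
  ultimately have "\<forall>\<^sub>F k in sequentially. P (X k) l"
  proof eventually_elim
    case (elim k)
    note small_k = elim(1) and near_k = elim(2)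
    have "\<forall>\<^sub>F j in sequentially. cover_depth (T j (A l) z) \<le> cover_depth z - 3 / 4 * A l powr p"
      using l b by auto
    then have "\<forall>\<^sub>F j in sequentially. cover_depth (T j (A l) (X k)) \<le> cover_depth (X k) - A l powr p / 2"
      using T_near[OF zM A[of l]]
    proof eventually_elim
      case (elim j)
      have T: "T j (A l) z \<in> M" "T j (A l) (X k) \<in> M" using zM X T_in by auto
      have near: "d z (X k) < \<rho> / 2" "d z (T j (A l) z) < \<rho> / 2"
        using near_k elim(2) l commute[of z "X k"] commute[of z "T j (A l) z"] by simp_all
      have iso: "d (T j (A l) z) (T j (A l) (X k)) = d (X k) z"
        using T_isometry[OF zM X(1)] commute[of z "X k"] by simp
      have "d z (T j (A l) (X k)) < \<rho>"
        using triangle[OF zM T] near iso near_k by linarith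
      then have 1: "\<bar>cover_depth (T j (A l) z) - cover_depth (T j (A l) (X k))\<bar> \<le> L * d (X k) z"
        using L[OF T] near \<rho> iso by simp
      have "d z z < \<rho>" "d z (X k) < \<rho>" using zM \<rho> near by simp_all
      then have 2: "\<bar>cover_depth z - cover_depth (X k)\<bar> \<le> L * d (X k) z"
        using L[OF zM X(1)[of k]] commute[of z "X k"] by simp
      show ?case using elim(1) small_k 1 2 by linarith
    qed
    then show "P (X k) l" by (auto simp: P_def intro: eventually_frequently)
  qed
  then have "\<forall>\<^sub>F k in sequentially. a k \<ge> A l powr p"
  proof eventually_elim
    case (elim k)
    then have "(LEAST l. P (X k) l) \<le> l" by (rule Least_le)
    then have "A l \<le> A (LEAST l. P (X k) l)" by (auto simp: A_def intro: power_decreasing)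
    then show ?case unfolding a_def using A[of l] p_ge_1 by (intro powr_mono2) auto
  qed
  moreover have "\<forall>\<^sub>F k in sequentially. a k < A l powr p"
    using summable_LIMSEQ_zero[OF summ] A[of l] by (intro order_tendstoD) auto
  ultimately have "\<forall>\<^sub>F k in sequentially. False"
    by eventually_elim auto
  then show False by simp
qed

section \<open>Baire category on the zero set of the cover depth\<close>

theorem point_finite_cover_imp_empty: "M = {}"
proof (rule ccontr)
  assume "M \<noteq> {}"
  then obtain x0 where x0: "x0 \<in> M" by auto
  define Z where "Z = {x \<in> M. cover_depth x = 0}"
  obtain z0 where z0: "z0 \<in> Z"
    using reach_zero_cover_depth[OF x0 x0] by (auto simp: Z_def)
  interpret Z: Submetric M d Z
    by unfold_locales (auto simp: Z_def)
  have Zc: "Z.sub.mcomplete"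
  proof (rule Z.sequentially_closedin_mcomplete_imp_mcomplete[OF complete])
    fix \<sigma> l assume \<sigma>: "range \<sigma> \<subseteq> Z \<and> limitin mtopology \<sigma> l sequentially"
    then have "cover_depth (\<sigma> n) = 0" for n by (auto simp: Z_def)
    then have "cover_depth l = 0"
      using cover_depth_tendsto[of \<sigma> l] \<sigma> by (simp add: LIMSEQ_const_iff)
    then show "l \<in> Z" using \<sigma> by (auto simp: Z_def limitin_mspace)
  qed
  define F where "F i = {x \<in> Z. d (c i) x \<le> r i}" for i
  have "Z.sub.mtopology interior_of Z = Z"
    by (metis Z.sub.topspace_mtopology interior_of_topspace)
  moreover have "Z = \<Union> (F ` J)"
    using cover by (auto simp: F_def Z_def)
  ultimately have "Z.sub.mtopology interior_of \<Union> (F ` J) \<noteq> {}"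
    using z0 by auto
  then obtain i where i: "i \<in> J" "\<not> (closedin Z.sub.mtopology (F i) \<and> Z.sub.mtopology interior_of (F i) = {})"
    using Z.sub.metric_Baire_category_alt[OF Zc, of "F ` J"] countable by auto
  have "F i = Z \<inter> mcball (c i) (r i)"
    using centre[OF i(1)] by (auto simp: F_def Z_def)
  then have "closedin Z.sub.mtopology (F i)"
    by (auto simp: Z.mtopology_submetric closedin_subtopology)
  with i obtain e where "e \<in> Z.sub.mtopology interior_of (F i)" by auto
  then obtain \<epsilon> where e: "e \<in> Z" "\<epsilon> > 0" "Z.sub.mball e \<epsilon> \<subseteq> F i"
    by (auto simp: Z.sub.metric_interior_of)
  have sub: "d (c i) z \<le> r i" if "z \<in> Z" "d e z < \<epsilon>" for z
    using e that by (auto simp: F_def)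
  have eM: "e \<in> M" "cover_depth e = 0" using e by (auto simp: Z_def)
  obtain \<rho> L where \<rho>: "\<rho> > 0" "L \<ge> 0"
    and L: "\<And>x y. x \<in> M \<Longrightarrow> y \<in> M \<Longrightarrow> d e x < \<rho> \<Longrightarrow> d e y < \<rho> \<Longrightarrow>
      \<bar>cover_depth x - cover_depth y\<bar> \<le> L * d x y"
    using cover_depth_locally_lipschitz[OF eM(1)] by metis
  \<comment> \<open>The bounds keep the moved point \<open>x\<close> within \<rho> and \<epsilon> /
    2 of \<open>e\<close>, and make \<open>4 * cover_depth x\<close>, which is at most
    \<open>8 * (L * a)\<close>, smaller than \<open>(\<epsilon> / 2) powr p\<close>.\<close>
  define a where "a = min (min (\<rho> / 2) (\<epsilon> / 4)) ((\<epsilon> / 2) powr p / (16 * (L + 1)))"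
  have a: "0 < a" "2 * a \<le> \<rho>" "4 * a \<le> \<epsilon>" using \<rho> e by (auto simp: a_def)
  have a4: "8 * (L * a) < (\<epsilon> / 2) powr p"
  proof -
    have "16 * (L + 1) * a \<le> 16 * (L + 1) * ((\<epsilon> / 2) powr p / (16 * (L + 1)))"
      using \<rho> by (intro mult_left_mono) (auto simp: a_def)
    also have "\<dots> = (\<epsilon> / 2) powr p" using \<rho> by simp
    finally have "16 * (L * a) + 16 * a \<le> (\<epsilon> / 2) powr p" by (simp add: algebra_simps)
    moreover have "0 \<le> L * a" using a \<rho> by simp
    ultimately show ?thesis using a by linarith
  qed
  \<comment> \<open>As \<open>e\<close> lies in the ball and has cover depth 0, its distance from
    the centre equals the radius; far moves from \<open>e\<close> therefore eventually leave the
    ball.\<close>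
  have "depth i e = 0"
    using depth_le_cover_depth[OF eM(1) i(1)] depth_nonneg_iff[OF i(1), of e] sub[of e] e eM by simp
  then have r: "d e (c i) powr p = r i powr p" by (simp add: depth_def commute)
  have "\<forall>\<^sub>F j in sequentially. d (T j a e) (c i) powr p > r i powr p"
    using T_far[of e "c i" a] eM centre[OF i(1)] a r by (intro order_tendstoD) auto
  then have "\<forall>\<^sub>F j in sequentially. d (T j a e) (c i) powr p > r i powr p \<and> d (T j a e) e < 2 * a"
    using T_near[OF eM(1) a(1)] by eventually_elim auto
  then obtain j where j: "d (T j a e) (c i) powr p > r i powr p" "d (T j a e) e < 2 * a"
    using eventually_happens'[OF sequentially_bot] by blast
  define x where "x = T j a e"
  have x: "x \<in> M" "d x e < 2 * a" "r i < d x (c i)"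
    using j eM T_in powr_mono2[of p "d x (c i)" "r i"] p_ge_1 by (force simp: x_def)+
  \<comment> \<open>The prescribed point is the centre: \<open>z\<close> is no nearer to it than
    \<open>x\<close> and hence outside the ball, while its closeness to \<open>e\<close> puts it
    inside.\<close>
  obtain z where z: "z \<in> M" "cover_depth z = 0" "d z x powr p \<le> 4 * cover_depth x" "d x (c i) \<le> d z (c i)"
    using reach_zero_cover_depth[OF x(1) centre[OF i(1)]] by metis
  have "cover_depth x \<le> L * d x e"
    using L[OF x(1) eM(1)] x a \<rho> eM commute[of x e] by simp
  also have "\<dots> \<le> 2 * (L * a)" using x \<rho> mult_left_mono[of "d x e" "2 * a" L] by simp
  finally have "d z x powr p < (\<epsilon> / 2) powr p" using z a4 by simp
  then have "d z x < \<epsilon> / 2"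
    using powr_mono2[of p "\<epsilon> / 2" "d z x"] p_ge_1 e by force
  then have "d e z < \<epsilon>"
    using triangle[of e x z] eM x z a commute[of e x] commute[of x z] by simp
  then have "d (c i) z \<le> r i" using sub z by (auto simp: Z_def)
  then show False using x z by (simp add: commute)
qed

end

section \<open>Smoothness and completeness of \<open>L\<^sup>p\<close>\<close>

text \<open>The terms linear in \<open>t\<close> cancel. If \<open>t\<close> is small compared with
  \<open>s\<close>, dividing by \<open>s\<close> reduces the claim to the vanishing derivative of
  \<open>(1 + \<tau>) powr p + (1 - \<tau>) powr p\<close> at 0; otherwise \<bar>s\<bar> is at most
  a multiple of \<bar>t\<bar> and the last term dominates.\<close>

lemma powr_symmetric_difference_small:
  fixes p \<epsilon> :: real
  assumes p: "1 < p" and \<epsilon>: "0 < \<epsilon>"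
  obtains C where "0 \<le> C"
    "\<And>s t. \<bar>s + t\<bar> powr p + \<bar>s - t\<bar> powr p
      \<le> 2 * \<bar>s\<bar> powr p + \<epsilon> * (\<bar>t\<bar> * \<bar>s\<bar> powr (p - 1)) + C * \<bar>t\<bar> powr p"
proof -
  have "((\<lambda>\<tau>. (1 + \<tau>) powr p + (1 - \<tau>) powr p) has_real_derivative 0) (at 0)"
    by (auto intro!: derivative_eq_intros)
  then have "((\<lambda>\<tau>. ((1 + \<tau>) powr p + (1 - \<tau>) powr p - 2) / \<tau>) \<longlongrightarrow> 0) (at 0)"
    by (simp add: DERIV_def)
  then have "\<forall>\<^sub>F \<tau> in at 0. \<bar>((1 + \<tau>) powr p + (1 - \<tau>) powr p - 2) / \<tau>\<bar> < \<epsilon>"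
    using \<epsilon> by (auto dest!: tendstoD simp: dist_real_def)
  then obtain \<delta>0 where \<delta>0: "\<delta>0 > 0"
    "\<And>\<tau>. \<tau> \<noteq> 0 \<Longrightarrow> \<bar>\<tau>\<bar> < \<delta>0 \<Longrightarrow> \<bar>((1 + \<tau>) powr p + (1 - \<tau>) powr p - 2) / \<tau>\<bar> < \<epsilon>"
    by (auto simp: eventually_at dist_real_def)
  define \<delta> where "\<delta> = min \<delta>0 1"
  have \<delta>: "0 < \<delta>" "\<delta> \<le> 1" using \<delta>0 by (auto simp: \<delta>_def)
  have small: "(1 + \<tau>) powr p + (1 - \<tau>) powr p \<le> 2 + \<epsilon> * \<bar>\<tau>\<bar>" if "\<bar>\<tau>\<bar> < \<delta>" for \<tau>
  proof (cases "\<tau> = 0")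
    case False
    then have "\<bar>(1 + \<tau>) powr p + (1 - \<tau>) powr p - 2\<bar> < \<epsilon> * \<bar>\<tau>\<bar>"
      using \<delta>0(2)[of \<tau>] that by (simp add: \<delta>_def abs_divide divide_less_eq)
    then show ?thesis by linarith
  qed simp
  define C where "C = 2 * (1 + 1 / \<delta>) powr p"
  have *: "\<bar>s + t\<bar> powr p + \<bar>s - t\<bar> powr p
      \<le> 2 * \<bar>s\<bar> powr p + \<epsilon> * (\<bar>t\<bar> * \<bar>s\<bar> powr (p - 1)) + C * \<bar>t\<bar> powr p" for s t :: real
  proof (cases "\<bar>t\<bar> < \<delta> * \<bar>s\<bar>")
    case True
    then have s: "s \<noteq> 0" using \<delta> by auto
    define \<tau> where "\<tau> = t / s"
    have \<tau>: "\<bar>\<tau>\<bar> < \<delta>" "t = \<tau> * s" using True s by (auto simp: \<tau>_def abs_divide divide_less_eq)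
    have "\<bar>s + t\<bar> = (1 + \<tau>) * \<bar>s\<bar>" "\<bar>s - t\<bar> = (1 - \<tau>) * \<bar>s\<bar>"
    proof -
      have "s + t = (1 + \<tau>) * s" "s - t = (1 - \<tau>) * s" by (simp_all add: \<tau>(2) algebra_simps)
      moreover have "0 < 1 + \<tau>" "0 < 1 - \<tau>" using \<tau>(1) \<delta> by auto
      ultimately show "\<bar>s + t\<bar> = (1 + \<tau>) * \<bar>s\<bar>" "\<bar>s - t\<bar> = (1 - \<tau>) * \<bar>s\<bar>"
        by (simp_all add: abs_mult)
    qed
    then have "\<bar>s + t\<bar> powr p + \<bar>s - t\<bar> powr p = ((1 + \<tau>) powr p + (1 - \<tau>) powr p) * \<bar>s\<bar> powr p"
      by (simp only: powr_mult distrib_right[of "(1 + \<tau>) powr p"])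
    also have "\<dots> \<le> (2 + \<epsilon> * \<bar>\<tau>\<bar>) * \<bar>s\<bar> powr p"
      using small[OF \<tau>(1)] by (intro mult_right_mono) auto
    also have "\<dots> = 2 * \<bar>s\<bar> powr p + \<epsilon> * (\<bar>t\<bar> * \<bar>s\<bar> powr (p - 1))"
      using powr_mult_base[of "\<bar>s\<bar>" "p - 1"] s by (simp add: \<tau>(2) abs_mult algebra_simps)
    finally show ?thesis by (simp add: C_def add_increasing2)
  next
    case False
    then have st: "\<bar>s\<bar> \<le> \<bar>t\<bar> / \<delta>" using \<delta> by (simp add: field_simps)
    have "\<bar>s + t\<bar> \<le> (1 + 1 / \<delta>) * \<bar>t\<bar>" "\<bar>s - t\<bar> \<le> (1 + 1 / \<delta>) * \<bar>t\<bar>"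
      using st by (auto simp: algebra_simps)
    then have "\<bar>s + t\<bar> powr p \<le> ((1 + 1 / \<delta>) * \<bar>t\<bar>) powr p" "\<bar>s - t\<bar> powr p \<le> ((1 + 1 / \<delta>) * \<bar>t\<bar>) powr p"
      using p by (auto intro!: powr_mono2)
    then have "\<bar>s + t\<bar> powr p + \<bar>s - t\<bar> powr p \<le> C * \<bar>t\<bar> powr p"
      by (simp add: C_def powr_mult)
    moreover have "0 \<le> 2 * \<bar>s\<bar> powr p + \<epsilon> * (\<bar>t\<bar> * \<bar>s\<bar> powr (p - 1))"
      using \<epsilon> by simp
    ultimately show ?thesis by linarith
  qed
  show ?thesis by (rule that[OF _ *]) (simp add: C_def)
qed

text \<open>A form of Young's inequality with a free weight, proved by comparing \<open>t\<close>
  with \<open>\<mu> * s\<close>. Integrated with a suitable \<mu>, it replaces Hoelder's inequality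
  in \<open>Lp_norm_flat\<close>.\<close>

lemma mult_powr_le_weighted:
  fixes p \<mu> s t :: real
  assumes p: "1 \<le> p" and \<mu>: "0 < \<mu>" and st: "0 \<le> s" "0 \<le> t"
  shows "t * s powr (p - 1) \<le> \<mu> * s powr p + \<mu> powr (1 - p) * t powr p"
proof (cases "t \<le> \<mu> * s")
  case True
  then have "t * s powr (p - 1) \<le> \<mu> * s * s powr (p - 1)"
    by (intro mult_right_mono) auto
  also have "\<dots> = \<mu> * s powr p"
    using powr_mult_base[of s "p - 1"] st by (simp add: mult.assoc)
  finally show ?thesis by (simp add: add_increasing2)
next
  case False
  then have "s \<le> t / \<mu>" using \<mu> by (simp add: field_simps)
  then have "t * s powr (p - 1) \<le> t * (t / \<mu>) powr (p - 1)"
    using p st by (intro mult_left_mono powr_mono2) auto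
  also have "\<dots> = \<mu> powr (1 - p) * (t * t powr (p - 1))"
    using \<mu> powr_minus_divide[of \<mu> "p - 1"] by (simp add: powr_divide)
  also have "\<dots> = \<mu> powr (1 - p) * t powr p"
    using powr_mult_base[of t "p - 1"] st by simp
  finally show ?thesis using \<mu> by (simp add: add_increasing)
qed

lemma Lp_norm_nonneg [simp]: "0 \<le> Lp_norm M p f"
  by (simp add: Lp_norm_def)

lemma Lp_norm_powr: "p \<noteq> 0 \<Longrightarrow> Lp_norm M p f powr p = (\<integral>x. \<bar>f x\<bar> powr p \<partial>M)"
  by (simp add: Lp_norm_def powr_powr)

lemma Lp_norm_scale:
  assumes "p \<noteq> 0"
  shows "Lp_norm M p (\<lambda>x. c * f x) = \<bar>c\<bar> * Lp_norm M p f"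
  using assms by (simp add: Lp_norm_def abs_mult powr_mult powr_powr)

lemma Lp_norm_uminus: "Lp_norm M p (\<lambda>x. - f x) = Lp_norm M p f"
  by (simp add: Lp_norm_def)

lemma Lp_norm_minus_commute: "Lp_norm M p (\<lambda>x. f x - g x) = Lp_norm M p (\<lambda>x. g x - f x)"
  by (simp add: Lp_norm_def abs_minus_commute)

text \<open>Integrating the pointwise inequality bounds the sum of the two \<open>p\<close>-th
  powers by \<open>2 * X powr p + e * X powr (p - 1)\<close>, where \<open>X\<close> is the norm of
  \<open>f\<close>. The error is one order below the main term, so after taking \<open>p\<close>-th
  roots it is an additive constant.\<close>

lemma Lp_norm_flat:
  assumes p: "1 < p" and g: "g \<in> Lp_fun M p" and e: "0 < e"
  obtains K where "\<And>f. f \<in> Lp_fun M p \<Longrightarrow> K \<le> Lp_norm M p f \<Longrightarrow>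
    Lp_norm M p (\<lambda>x. f x + g x) + Lp_norm M p (\<lambda>x. f x - g x) \<le> 2 * Lp_norm M p f + e"
proof -
  \<comment> \<open>The 1 keeps \<open>W\<close> positive even if \<open>g\<close> has norm 0. Three
    errors of size \<open>\<epsilon> * W * X powr (p - 1)\<close> will arise, whence the 3 in the
    choice of \<epsilon>.\<close>
  define W where "W = Lp_norm M p g + 1"
  have W: "0 < W" "Lp_norm M p g \<le> W" by (simp_all add: W_def add_nonneg_pos)
  define \<epsilon> where "\<epsilon> = e / (3 * W)"
  have \<epsilon>: "0 < \<epsilon>" using e W by (simp add: \<epsilon>_def)
  obtain C where C: "0 \<le> C" "\<And>s t. \<bar>s + t\<bar> powr p + \<bar>s - t\<bar> powr p
      \<le> 2 * \<bar>s\<bar> powr p + \<epsilon> * (\<bar>t\<bar> * \<bar>s\<bar> powr (p - 1)) + C * \<bar>t\<bar> powr p"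
    using powr_symmetric_difference_small[OF p \<epsilon>] by metis
  \<comment> \<open>This makes the remainder \<open>C * W powr p\<close> at most
    \<open>\<epsilon> * W * X powr (p - 1)\<close> once \<open>X \<ge> K\<close>.\<close>
  define K where "K = max 1 ((C * W powr p / (\<epsilon> * W)) powr (1 / (p - 1)))"
  show ?thesis
  proof (rule that[of K])
    fix f assume f: "f \<in> Lp_fun M p" and K: "K \<le> Lp_norm M p f"
    define X where "X = Lp_norm M p f"
    define A where "A = Lp_norm M p (\<lambda>x. f x + g x)"
    define B where "B = Lp_norm M p (\<lambda>x. f x - g x)"
    have X: "1 \<le> X" using K by (simp add: X_def K_def)
    have AB: "0 \<le> A" "0 \<le> B" by (simp_all add: A_def B_def)
    \<comment> \<open>This weight makes both terms of \<open>mult_powr_le_weighted\<close> equal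
      after integration, with the norm of \<open>g\<close> replaced by \<open>W\<close>.\<close>
    define \<mu> where "\<mu> = W / X"
    have \<mu>: "0 < \<mu>" using W X by (simp add: \<mu>_def)
    have i: "integrable M (\<lambda>x. \<bar>f x\<bar> powr p)" "integrable M (\<lambda>x. \<bar>g x\<bar> powr p)"
      "integrable M (\<lambda>x. \<bar>f x + g x\<bar> powr p)" "integrable M (\<lambda>x. \<bar>f x - g x\<bar> powr p)"
      using f g Lp_fun_add[OF _ f g] Lp_fun_diff[OF _ f g] p by (auto simp: Lp_fun_def)
    have "A powr p + B powr p = (\<integral>x. \<bar>f x + g x\<bar> powr p + \<bar>f x - g x\<bar> powr p \<partial>M)"
      using i p by (simp add: A_def B_def Lp_norm_powr)
    also have "\<dots> \<le> (\<integral>x. 2 * \<bar>f x\<bar> powr p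
        + \<epsilon> * (\<mu> * \<bar>f x\<bar> powr p + \<mu> powr (1 - p) * \<bar>g x\<bar> powr p) + C * \<bar>g x\<bar> powr p \<partial>M)"
    proof (rule integral_mono)
      fix x
      have "\<epsilon> * (\<bar>g x\<bar> * \<bar>f x\<bar> powr (p - 1))
          \<le> \<epsilon> * (\<mu> * \<bar>f x\<bar> powr p + \<mu> powr (1 - p) * \<bar>g x\<bar> powr p)"
        using \<epsilon> p \<mu> by (intro mult_left_mono mult_powr_le_weighted) auto
      then show "\<bar>f x + g x\<bar> powr p + \<bar>f x - g x\<bar> powr p \<le> 2 * \<bar>f x\<bar> powr p
        + \<epsilon> * (\<mu> * \<bar>f x\<bar> powr p + \<mu> powr (1 - p) * \<bar>g x\<bar> powr p) + C * \<bar>g x\<bar> powr p"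
        using C(2)[of "f x" "g x"] by linarith
    qed (use i in auto)
    also have "\<dots> = 2 * X powr p + \<epsilon> * (\<mu> * X powr p + \<mu> powr (1 - p) * Lp_norm M p g powr p)
        + C * Lp_norm M p g powr p"
      using i p by (simp add: X_def Lp_norm_powr)
    also have "\<dots> \<le> 2 * X powr p + \<epsilon> * (\<mu> * X powr p + \<mu> powr (1 - p) * W powr p) + C * W powr p"
      using W \<epsilon> C(1) p X \<mu> by (intro add_mono mult_left_mono powr_mono2) auto
    also have "\<mu> * X powr p = W * X powr (p - 1)"
      using X powr_mult_base[of X "p - 1"] by (simp add: \<mu>_def field_simps)
    also have "\<mu> powr (1 - p) * W powr p = W * X powr (p - 1)"
    proof -
      have "\<mu> powr (1 - p) = W powr (1 - p) * X powr (p - 1)"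
        using X W powr_minus_divide[of X "p - 1"] by (simp add: \<mu>_def powr_divide)
      moreover have "W powr (1 - p) * W powr p = W"
        using W by (simp add: powr_add[symmetric])
      ultimately show ?thesis by (simp add: mult.commute mult.left_commute)
    qed
    also have "C * W powr p \<le> \<epsilon> * W * X powr (p - 1)"
    proof -
      have "(C * W powr p / (\<epsilon> * W)) powr (1 / (p - 1)) \<le> X"
        using K by (simp add: X_def K_def)
      then have "((C * W powr p / (\<epsilon> * W)) powr (1 / (p - 1))) powr (p - 1) \<le> X powr (p - 1)"
        using p by (intro powr_mono2) auto
      then have "C * W powr p / (\<epsilon> * W) \<le> X powr (p - 1)"
        using p C(1) \<epsilon> W by (simp add: powr_powr)
      then show ?thesis using \<epsilon> W by (simp add: field_simps)
    qed
    finally have 1: "A powr p + B powr p \<le> 2 * X powr p + e * X powr (p - 1)"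
      using W by (simp add: \<epsilon>_def field_simps)
    \<comment> \<open>Convexity passes to the mean of the two norms;
      \<open>1 + u \<le> (1 + u) powr p\<close> for \<open>u \<ge> 0\<close> then makes the right
      side a \<open>p\<close>-th power.\<close>
    have "((A + B) / 2) powr p \<le> (A powr p + B powr p) / 2"
      using powr_convex_combination[of p "1 / 2" A B] p AB by (simp add: field_simps)
    also have "\<dots> \<le> X powr p + e / 2 * X powr (p - 1)" using 1 by simp
    also have "\<dots> = X powr p * (1 + e / 2 / X)"
      using X powr_mult_base[of X "p - 1"] by (simp add: field_simps)
    also have "\<dots> \<le> X powr p * (1 + e / 2 / X) powr p"
      using X e p powr_mono[of 1 p "1 + e / 2 / X"] by (intro mult_left_mono) auto
    also have "\<dots> = (X * (1 + e / 2 / X)) powr p"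
      by (simp add: powr_mult)
    also have "X * (1 + e / 2 / X) = X + e / 2"
      using X by (simp add: field_simps)
    finally have "(A + B) / 2 \<le> X + e / 2"
      using powr_less_mono2[of p "X + e / 2" "(A + B) / 2"] p X e by force
    then show "Lp_norm M p (\<lambda>x. f x + g x) + Lp_norm M p (\<lambda>x. f x - g x) \<le> 2 * Lp_norm M p f + e"
      by (simp add: A_def B_def X_def field_simps)
  qed
qed

section \<open>Completeness\<close>

lemma Lp_spaceE:
  assumes "F \<in> Lp_space M p"
  obtains f where "f \<in> Lp_fun M p" "F = Lp_class M p f"
  using assms by (auto simp: Lp_space_def Lp_class_def elim!: quotientE)

lemma Lp_class_in_space: "f \<in> Lp_fun M p \<Longrightarrow> Lp_class M p f \<in> Lp_space M p"
  by (auto simp: Lp_space_def Lp_class_def intro: quotientI)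

lemma Lp_norm_sum_le:
  fixes n :: nat
  assumes p: "1 \<le> p" and f: "\<And>i. i < n \<Longrightarrow> f i \<in> Lp_fun M p"
  shows "(\<lambda>x. \<Sum>i<n. f i x) \<in> Lp_fun M p \<and> Lp_norm M p (\<lambda>x. \<Sum>i<n. f i x) \<le> (\<Sum>i<n. Lp_norm M p (f i))"
  using f
proof (induction n)
  case 0
  then show ?case using p by (simp add: Lp_fun_def Lp_norm_def)
next
  case (Suc n)
  then have *: "(\<lambda>x. \<Sum>i<n. f i x) \<in> Lp_fun M p"
      "Lp_norm M p (\<lambda>x. \<Sum>i<n. f i x) \<le> (\<Sum>i<n. Lp_norm M p (f i))" "f n \<in> Lp_fun M p"
    by auto
  show ?case
    using Lp_fun_add[OF p *(1) *(3)] Lp_norm_triangle[OF p *(1) *(3)] *(2) by simp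
qed

lemma Lp_nn_integral:
  assumes "f \<in> Lp_fun M p" "0 < p"
  shows "(\<integral>\<^sup>+x. ennreal (\<bar>f x\<bar> powr p) \<partial>M) = ennreal (Lp_norm M p f powr p)"
  using assms by (subst nn_integral_eq_integral) (auto simp: Lp_fun_def Lp_norm_powr)

lemma Lp_fun_nn_integral_bound:
  assumes f: "f \<in> borel_measurable M" and p: "0 < p" and b: "0 \<le> b"
    and le: "(\<integral>\<^sup>+x. ennreal (\<bar>f x\<bar> powr p) \<partial>M) \<le> ennreal (b powr p)"
  shows "f \<in> Lp_fun M p \<and> Lp_norm M p f \<le> b"
proof -
  have "integrable M (\<lambda>x. \<bar>f x\<bar> powr p)"
    using f le by (intro integrableI_bounded) (auto simp: top_unique less_top[symmetric] intro: order_le_less_trans)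
  then have 1: "f \<in> Lp_fun M p" using f by (simp add: Lp_fun_def)
  then have "Lp_norm M p f powr p \<le> b powr p"
    using le Lp_nn_integral[OF 1 p] by simp
  then show ?thesis
    using 1 powr_less_mono2[of p b "Lp_norm M p f"] p b by force
qed

text \<open>The Riesz-Fischer argument. Along a subsequence with increments at most
  \<open>(1 / 2) ^ k\<close>, the sums of the absolute increments have norm at most 2; by monotone
  convergence they are bounded almost everywhere, so the subsequence converges there, and Fatou's
  lemma bounds the distance to the limit.\<close>

lemma Lp_mcomplete:
  assumes p: "1 \<le> p"
  shows "Metric_space.mcomplete (Lp_space M p) (Lp_dist M p)"
proof -
  interpret Metric_space "Lp_space M p" "Lp_dist M p"
    by (rule Metric_space_Lp[OF p])
  show ?thesis
    unfolding mcomplete_def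
  proof (intro allI impI)
    fix \<sigma> assume \<sigma>: "MCauchy \<sigma>"
    have "\<exists>f. f \<in> Lp_fun M p \<and> \<sigma> n = Lp_class M p f" for n
    proof -
      have "\<sigma> n \<in> Lp_space M p" using \<sigma> by (auto simp: MCauchy_def)
      then show ?thesis by (metis Lp_spaceE)
    qed
    then obtain f where f: "\<And>n. f n \<in> Lp_fun M p" "\<And>n. \<sigma> n = Lp_class M p (f n)"
      by metis
    define N where "N k = (SOME N. \<forall>n n'. N \<le> n \<longrightarrow> N \<le> n' \<longrightarrow> Lp_dist M p (\<sigma> n) (\<sigma> n') < (1 / 2) ^ k)" for k :: nat
    have N: "Lp_dist M p (\<sigma> n) (\<sigma> n') < (1 / 2) ^ k" if "N k \<le> n" "N k \<le> n'" for n n' k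
    proof -
      have "\<exists>N. \<forall>n n'. N \<le> n \<longrightarrow> N \<le> n' \<longrightarrow> Lp_dist M p (\<sigma> n) (\<sigma> n') < (1 / 2) ^ k"
        using \<sigma> by (simp add: MCauchy_def)
      from someI_ex[OF this] that show ?thesis by (simp add: N_def)
    qed
    \<comment> \<open>The maximum makes \<open>r\<close> strictly increasing and keeps
      \<open>r k\<close> beyond the threshold \<open>N k\<close>.\<close>
    define r where "r = rec_nat (N 0) (\<lambda>k n. max (Suc n) (N (Suc k)))"
    have rSuc: "r (Suc k) = max (Suc (r k)) (N (Suc k))" for k by (simp add: r_def)
    have "strict_mono r" by (auto simp: strict_mono_Suc_iff rSuc)
    have rN: "N k \<le> r k" for k by (cases k) (auto simp: r_def)
    define h where "h k = f (r k)" for k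
    have h: "h k \<in> Lp_fun M p" for k by (simp add: h_def f)
    have hm[measurable]: "h k \<in> borel_measurable M" for k using h by (auto simp: Lp_fun_def)
    have dist: "Lp_norm M p (\<lambda>x. h n x - h k x) \<le> (1 / 2) ^ k" if "k \<le> n" for k n
    proof -
      have "N k \<le> r n" using rN[of k] strict_mono_less_eq[OF \<open>strict_mono r\<close>] that by (meson le_trans)
      then have "Lp_dist M p (\<sigma> (r n)) (\<sigma> (r k)) < (1 / 2) ^ k" using N rN by blast
      then show ?thesis using Lp_dist_class[OF p f(1) f(1)] by (simp add: f(2) h_def)
    qed
    define u where "u k x = \<bar>h (Suc k) x - h k x\<bar>" for k x
    have u: "u k \<in> Lp_fun M p" for k
      using Lp_fun_diff[OF p h h] by (auto simp: Lp_fun_def u_def[abs_def])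
    have un: "Lp_norm M p (u k) \<le> (1 / 2) ^ k" for k
      using dist[of k "Suc k"] by (simp add: u_def[abs_def] Lp_norm_def)
    define S where "S n x = (\<Sum>k<n. u k x)" for n x
    have S: "S n \<in> Lp_fun M p" "Lp_norm M p (S n) \<le> 2" for n
    proof -
      have "Lp_norm M p (S n) \<le> (\<Sum>k<n. Lp_norm M p (u k))" and "S n \<in> Lp_fun M p"
        using Lp_norm_sum_le[OF p, of n u M] u by (auto simp: S_def[abs_def])
      moreover have "(\<Sum>k<n. Lp_norm M p (u k)) \<le> (\<Sum>k<n. (1 / 2) ^ k)" by (intro sum_mono un)
      moreover have "(\<Sum>k<n. (1 / 2 :: real) ^ k) \<le> 2" by (simp add: sum_gp_strict)
      ultimately show "S n \<in> Lp_fun M p" "Lp_norm M p (S n) \<le> 2" by auto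
    qed
    have S0: "0 \<le> S n x" for n x by (auto simp: S_def u_def intro: sum_nonneg)
    have Sm[measurable]: "S n \<in> borel_measurable M" for n using S by (auto simp: Lp_fun_def)
    have "(\<integral>\<^sup>+x. (SUP n. ennreal (S n x powr p)) \<partial>M) = (SUP n. \<integral>\<^sup>+x. ennreal (S n x powr p) \<partial>M)"
    proof (rule nn_integral_monotone_convergence_SUP)
      show "incseq (\<lambda>n x. ennreal (S n x powr p))"
        using p S0 by (intro incseq_SucI le_funI ennreal_leI powr_mono2) (auto simp: S_def u_def)
    qed simp
    also have "\<dots> \<le> ennreal (2 powr p)"
    proof (rule SUP_least)
      fix n
      have "(\<integral>\<^sup>+x. ennreal (S n x powr p) \<partial>M) = ennreal (Lp_norm M p (S n) powr p)"
        using Lp_nn_integral[OF S(1)[of n]] p S0 by simp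
      also have "\<dots> \<le> ennreal (2 powr p)"
        using S(2)[of n] p by (intro ennreal_leI powr_mono2) auto
      finally show "(\<integral>\<^sup>+x. ennreal (S n x powr p) \<partial>M) \<le> ennreal (2 powr p)" .
    qed
    finally have "(\<integral>\<^sup>+x. (SUP n. ennreal (S n x powr p)) \<partial>M) \<noteq> \<infinity>"
      by (auto simp: top_unique)
    then have "AE x in M. (SUP n. ennreal (S n x powr p)) \<noteq> \<infinity>"
      by (intro nn_integral_PInf_AE) auto
    then have conv: "AE x in M. convergent (\<lambda>n. h n x)"
    proof eventually_elim
      case (elim x)
      then obtain b where b: "0 \<le> b" "(SUP n. ennreal (S n x powr p)) = ennreal b"
        by (cases "SUP n. ennreal (S n x powr p)") auto
      have Sb: "S n x \<le> b powr (1 / p)" for n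
      proof -
        have "ennreal (S n x powr p) \<le> ennreal b"
          using SUP_upper[of n UNIV "\<lambda>n. ennreal (S n x powr p)"] by (simp add: b)
        then have "(S n x powr p) powr (1 / p) \<le> b powr (1 / p)"
          using b p by (intro powr_mono2) auto
        then show ?thesis using p S0 by (simp add: powr_powr)
      qed
      have "summable (\<lambda>k. u k x)"
      proof (rule bounded_imp_summable)
        show "(\<Sum>k\<le>n. u k x) \<le> b powr (1 / p)" for n
          using Sb[of "Suc n"] by (simp only: S_def lessThan_Suc_atMost)
      qed (simp add: u_def)
      then have "summable (\<lambda>k. h (Suc k) x - h k x)"
        by (intro summable_norm_cancel[of "\<lambda>k. h (Suc k) x - h k x"]) (simp add: u_def)
      then have "convergent (\<lambda>n. \<Sum>k<n. h (Suc k) x - h k x)"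
        by (simp add: summable_iff_convergent)
      then have "convergent (\<lambda>n. h n x - h 0 x)"
        by (simp only: sum_lessThan_telescope[of "\<lambda>k. h k x"])
      then show ?case by (simp add: convergent_diff_const_right_iff)
    qed
    define g where "g x = lim (\<lambda>n. h n x)" for x
    have gm[measurable]: "g \<in> borel_measurable M"
      unfolding g_def[abs_def] by measurable
    have gh: "(\<lambda>x. g x - h k x) \<in> Lp_fun M p \<and> Lp_norm M p (\<lambda>x. g x - h k x) \<le> (1 / 2) ^ k" for k
    proof (rule Lp_fun_nn_integral_bound)
      have "(\<integral>\<^sup>+x. ennreal (\<bar>g x - h k x\<bar> powr p) \<partial>M)
          = (\<integral>\<^sup>+x. liminf (\<lambda>n. ennreal (\<bar>h n x - h k x\<bar> powr p)) \<partial>M)"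
      proof (rule nn_integral_cong_AE)
        show "AE x in M. ennreal (\<bar>g x - h k x\<bar> powr p) = liminf (\<lambda>n. ennreal (\<bar>h n x - h k x\<bar> powr p))"
          using conv
        proof eventually_elim
          case (elim x)
          then have "(\<lambda>n. h n x) \<longlonglongrightarrow> g x" by (simp add: g_def convergent_LIMSEQ_iff)
          then have "(\<lambda>n. ennreal (\<bar>h n x - h k x\<bar> powr p)) \<longlonglongrightarrow> ennreal (\<bar>g x - h k x\<bar> powr p)"
            using p by (intro tendsto_intros tendsto_powr2) auto
          from lim_imp_Liminf[OF sequentially_bot this] show ?case by simp
        qed
      qed
      also have "\<dots> \<le> liminf (\<lambda>n. \<integral>\<^sup>+x. ennreal (\<bar>h n x - h k x\<bar> powr p) \<partial>M)"
        by (intro nn_integral_liminf) auto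
      also have "\<dots> \<le> ennreal (((1 / 2) ^ k) powr p)"
      proof (rule Liminf_le)
        have "(\<integral>\<^sup>+x. ennreal (\<bar>h n x - h k x\<bar> powr p) \<partial>M) \<le> ennreal (((1 / 2) ^ k) powr p)" if "k \<le> n" for n
          using Lp_nn_integral[OF Lp_fun_diff[OF p h h]] p dist[OF that]
          by (auto intro!: ennreal_leI powr_mono2)
        then show "\<forall>\<^sub>F n in sequentially.
            (\<integral>\<^sup>+x. ennreal (\<bar>h n x - h k x\<bar> powr p) \<partial>M) \<le> ennreal (((1 / 2) ^ k) powr p)"
          by (intro eventually_sequentiallyI[of k]) blast
      qed simp
      finally show "(\<integral>\<^sup>+x. ennreal (\<bar>g x - h k x\<bar> powr p) \<partial>M) \<le> ennreal (((1 / 2) ^ k) powr p)" .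
    qed (use p in auto)
    have g: "g \<in> Lp_fun M p"
      using Lp_fun_add[OF p conjunct1[OF gh[of 0]] h[of 0]] by simp
    have "limitin mtopology (\<sigma> \<circ> r) (Lp_class M p g) sequentially"
      unfolding limitin_metric_dist_null
    proof (intro conjI)
      show "\<forall>\<^sub>F k in sequentially. (\<sigma> \<circ> r) k \<in> Lp_space M p"
        by (simp add: f Lp_class_in_space)
      have le: "Lp_dist M p ((\<sigma> \<circ> r) k) (Lp_class M p g) \<le> (1 / 2) ^ k" for k
      proof -
        have "Lp_dist M p ((\<sigma> \<circ> r) k) (Lp_class M p g) = Lp_norm M p (\<lambda>x. h k x - g x)"
          using Lp_dist_class[OF p f(1) g] by (simp add: f(2) h_def)
        also have "\<dots> = Lp_norm M p (\<lambda>x. g x - h k x)"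
          by (rule Lp_norm_minus_commute)
        finally show ?thesis using gh[of k] by simp
      qed
      show "(\<lambda>k. Lp_dist M p ((\<sigma> \<circ> r) k) (Lp_class M p g)) \<longlonglongrightarrow> 0"
      proof (rule Lim_null_comparison)
        show "\<forall>\<^sub>F k in sequentially. norm (Lp_dist M p ((\<sigma> \<circ> r) k) (Lp_class M p g)) \<le> (1 / 2) ^ k"
          using le by (intro always_eventually allI) (simp only: real_norm_def abs_of_nonneg nonneg)
        show "(\<lambda>k. (1 / 2 :: real) ^ k) \<longlonglongrightarrow> 0" by (rule LIMSEQ_power_zero) simp
      qed
    qed (simp add: g Lp_class_in_space)
    then show "\<exists>F. limitin mtopology \<sigma> F sequentially"
      using MCauchy_convergent_subsequence[OF \<sigma> \<open>strict_mono r\<close>] by blast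
  qed
qed

section \<open>Disjoint sequences of sets of finite positive measure\<close>

definition finite_positive_sets :: "'a measure \<Rightarrow> 'a set set" where
  "finite_positive_sets M = {A \<in> sets M. 0 < emeasure M A \<and> emeasure M A < \<infinity>}"

text \<open>Finite families of every size are required instead of an infinite sequence: in this form
  the property passes to one of two pieces of \<open>E\<close>.\<close>

definition unbounded_packing :: "'a measure \<Rightarrow> 'a set \<Rightarrow> bool" where
  "unbounded_packing M E \<longleftrightarrow>
    (\<forall>n. \<exists>\<F>. finite \<F> \<and> n \<le> card \<F> \<and> \<F> \<subseteq> finite_positive_sets M \<and> disjoint \<F> \<and> \<Union>\<F> \<subseteq> E)"

lemma finite_positive_sets_subset: "A \<in> finite_positive_sets M \<Longrightarrow> B \<in> sets M \<Longrightarrow> B \<subseteq> A \<Longrightarrow> 0 < emeasure M B \<Longrightarrow> B \<in> finite_positive_sets M"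
  using emeasure_mono[of B A M] by (auto simp: finite_positive_sets_def intro: le_less_trans)

lemma finite_positive_sets_nonempty: "A \<in> finite_positive_sets M \<Longrightarrow> A \<noteq> {}"
  by (auto simp: finite_positive_sets_def)

lemma finite_positive_sets_D: "A \<in> finite_positive_sets M \<Longrightarrow> A \<in> sets M" "A \<in> finite_positive_sets M \<Longrightarrow> 0 < measure M A"
  "A \<in> finite_positive_sets M \<Longrightarrow> emeasure M A < \<infinity>"
  by (auto simp: finite_positive_sets_def measure_def enn2real_positive_iff)

text \<open>Each set of positive measure has a trace of positive measure on \<open>A\<close> or on
  its complement. So \<open>m + n\<close> disjoint sets leave \<open>m\<close> such traces on one
  side or \<open>n\<close> on the other; nonempty traces of disjoint sets are distinct, so none is
  lost in counting.\<close>

lemma unbounded_packing_split: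
  assumes E: "unbounded_packing M E" and A: "A \<in> sets M"
  shows "unbounded_packing M (E \<inter> A) \<or> unbounded_packing M (E - A)"
proof (rule ccontr)
  assume "\<not> ?thesis"
  then obtain m n where m: "\<And>\<F>. finite \<F> \<Longrightarrow> \<F> \<subseteq> finite_positive_sets M \<Longrightarrow> disjoint \<F> \<Longrightarrow> \<Union>\<F> \<subseteq> E \<inter> A \<Longrightarrow> card \<F> < m"
    and n: "\<And>\<F>. finite \<F> \<Longrightarrow> \<F> \<subseteq> finite_positive_sets M \<Longrightarrow> disjoint \<F> \<Longrightarrow> \<Union>\<F> \<subseteq> E - A \<Longrightarrow> card \<F> < n"
    unfolding unbounded_packing_def by (metis not_le)
  obtain \<F> where \<F>: "finite \<F>" "m + n \<le> card \<F>" "\<F> \<subseteq> finite_positive_sets M" "disjoint \<F>" "\<Union>\<F> \<subseteq> E"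
    using E unfolding unbounded_packing_def by metis
  have trace: "card {F \<in> \<F>. F \<inter> X \<in> finite_positive_sets M} < k"
    if k: "\<And>\<F>. finite \<F> \<Longrightarrow> \<F> \<subseteq> finite_positive_sets M \<Longrightarrow> disjoint \<F> \<Longrightarrow> \<Union>\<F> \<subseteq> E \<inter> X \<Longrightarrow> card \<F> < k" for k X
  proof -
    let ?G = "{F \<in> \<F>. F \<inter> X \<in> finite_positive_sets M}"
    have "inj_on (\<lambda>F. F \<inter> X) ?G"
    proof (rule inj_onI)
      fix F G assume FG: "F \<in> ?G" "G \<in> ?G" "F \<inter> X = G \<inter> X"
      then have "F \<inter> G \<noteq> {}" using finite_positive_sets_nonempty[of "F \<inter> X" M] by auto
      then show "F = G" using FG \<F>(4) by (auto simp: disjoint_def)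
    qed
    moreover have "card ((\<lambda>F. F \<inter> X) ` ?G) < k"
    proof (rule k)
      show "disjoint ((\<lambda>F. F \<inter> X) ` ?G)"
        using \<F>(4) by (fastforce simp: disjoint_def)
    qed (use \<F> in auto)
    ultimately show ?thesis by (simp add: card_image)
  qed
  have "card {F \<in> \<F>. F \<inter> A \<in> finite_positive_sets M} < m"
    by (rule trace, rule m) auto
  moreover have "card {F \<in> \<F>. F \<inter> - A \<in> finite_positive_sets M} < n"
    by (rule trace, rule n) auto
  moreover have "\<F> \<subseteq> {F \<in> \<F>. F \<inter> A \<in> finite_positive_sets M} \<union> {F \<in> \<F>. F \<inter> - A \<in> finite_positive_sets M}"
  proof
    fix F assume F: "F \<in> \<F>"
    then have F': "F \<in> finite_positive_sets M" "F \<in> sets M" using \<F> by (auto simp: finite_positive_sets_def)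
    have "emeasure M F = emeasure M (F \<inter> A) + emeasure M (F - A)"
      using A F' by (subst plus_emeasure) (auto simp: Int_Diff_Un)
    then have "0 < emeasure M (F \<inter> A) \<or> 0 < emeasure M (F - A)"
      using F' by (auto simp: finite_positive_sets_def zero_less_iff_neq_zero)
    moreover have "F \<inter> - A = F - A" by auto
    ultimately show "F \<in> {F \<in> \<F>. F \<inter> A \<in> finite_positive_sets M} \<union> {F \<in> \<F>. F \<inter> - A \<in> finite_positive_sets M}"
      using F F' A finite_positive_sets_subset[of F M "F \<inter> A"] finite_positive_sets_subset[of F M "F - A"]
      by auto
  qed
  then have "card \<F> \<le> card {F \<in> \<F>. F \<inter> A \<in> finite_positive_sets M} + card {F \<in> \<F>. F \<inter> - A \<in> finite_positive_sets M}"
    using \<F>(1) by (intro order_trans[OF card_mono card_Un_le]) auto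
  ultimately show False using \<F>(2) by linarith
qed

text \<open>In every step one set is taken and a remainder disjoint from it, again of unbounded
  packing, is kept; all later sets lie in this remainder.\<close>

lemma unbounded_packing_disjoint_sequence:
  assumes "unbounded_packing M E0"
  obtains A :: "nat \<Rightarrow> 'a set" where "disjoint_family A" "\<And>j. A j \<in> finite_positive_sets M"
proof -
  have step: "\<exists>A E'. A \<in> finite_positive_sets M \<and> A \<subseteq> E \<and> E' \<subseteq> E \<and> A \<inter> E' = {} \<and> unbounded_packing M E'"
    if E: "unbounded_packing M E" for E
  proof -
    obtain \<F> where \<F>: "finite \<F>" "2 \<le> card \<F>" "\<F> \<subseteq> finite_positive_sets M" "disjoint \<F>" "\<Union>\<F> \<subseteq> E"
      using E unfolding unbounded_packing_def by metis
    then obtain \<G> where "\<G> \<subseteq> \<F>" "card \<G> = 2" by (meson obtain_subset_with_card_n)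
    then obtain A B where AB: "A \<in> \<F>" "B \<in> \<F>" "A \<noteq> B" by (auto simp: card_2_iff)
    then have AB': "A \<in> finite_positive_sets M" "B \<in> finite_positive_sets M" "A \<inter> B = {}" "A \<subseteq> E" "B \<subseteq> E"
      using \<F> by (auto simp: disjoint_def)
    \<comment> \<open>If the packing is unbounded inside \<open>A\<close>, then \<open>A\<close> is
      the remainder and \<open>B\<close> is taken; otherwise \<open>A\<close> itself is
      taken.\<close>
    from unbounded_packing_split[OF E finite_positive_sets_D(1)[OF AB'(1)]] show ?thesis
    proof
      assume "unbounded_packing M (E \<inter> A)"
      then show ?thesis using AB' by (intro exI[of _ B] exI[of _ "E \<inter> A"]) auto
    next
      assume "unbounded_packing M (E - A)"
      then show ?thesis using AB' by (intro exI[of _ A] exI[of _ "E - A"]) auto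
    qed
  qed
  have "\<exists>f :: nat \<Rightarrow> 'a set \<times> 'a set. \<forall>n.
      (fst (f n) \<in> finite_positive_sets M \<and> fst (f n) \<inter> snd (f n) = {} \<and> unbounded_packing M (snd (f n)))
      \<and> (fst (f (Suc n)) \<subseteq> snd (f n) \<and> snd (f (Suc n)) \<subseteq> snd (f n))"
  proof (rule dependent_nat_choice)
    show "\<exists>s :: 'a set \<times> 'a set. fst s \<in> finite_positive_sets M \<and> fst s \<inter> snd s = {} \<and> unbounded_packing M (snd s)"
    proof -
      obtain A E where "A \<in> finite_positive_sets M" "A \<inter> E = {}" "unbounded_packing M E"
        using step[OF assms] by blast
      then show ?thesis by (intro exI[of _ "(A, E)"]) simp
    qed
    fix s :: "'a set \<times> 'a set" and n :: nat
    assume "fst s \<in> finite_positive_sets M \<and> fst s \<inter> snd s = {} \<and> unbounded_packing M (snd s)"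
    then show "\<exists>t. (fst t \<in> finite_positive_sets M \<and> fst t \<inter> snd t = {} \<and> unbounded_packing M (snd t))
        \<and> (fst t \<subseteq> snd s \<and> snd t \<subseteq> snd s)"
    proof -
      assume s: "fst s \<in> finite_positive_sets M \<and> fst s \<inter> snd s = {} \<and> unbounded_packing M (snd s)"
      obtain A E where "A \<in> finite_positive_sets M" "A \<subseteq> snd s" "E \<subseteq> snd s" "A \<inter> E = {}" "unbounded_packing M E"
        using step[of "snd s"] s by blast
      then show ?thesis by (intro exI[of _ "(A, E)"]) simp
    qed
  qed
  then obtain f :: "nat \<Rightarrow> 'a set \<times> 'a set"
    where "\<forall>n. (fst (f n) \<in> finite_positive_sets M \<and> fst (f n) \<inter> snd (f n) = {} \<and> unbounded_packing M (snd (f n)))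
      \<and> (fst (f (Suc n)) \<subseteq> snd (f n) \<and> snd (f (Suc n)) \<subseteq> snd (f n))" ..
  then have f: "fst (f n) \<in> finite_positive_sets M" "fst (f n) \<inter> snd (f n) = {}"
      "fst (f (Suc n)) \<subseteq> snd (f n)" "snd (f (Suc n)) \<subseteq> snd (f n)" for n
    by simp_all
  have sub: "m \<le> n \<Longrightarrow> snd (f n) \<subseteq> snd (f m)" for m n
    by (rule lift_Suc_antimono_le[of "\<lambda>n. snd (f n)"]) (rule f(4))
  have dis: "fst (f m) \<inter> fst (f n) = {}" if "m < n" for m n
  proof -
    have "fst (f n) \<subseteq> snd (f (n - 1))" using f(3)[of "n - 1"] that by simp
    also have "\<dots> \<subseteq> snd (f m)" using that by (intro sub) simp
    finally show ?thesis using f(2)[of m] by blast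
  qed
  have "disjoint_family (\<lambda>n. fst (f n))"
    unfolding disjoint_family_on_def
  proof (intro ballI impI)
    fix m n :: nat assume "m \<noteq> n"
    then consider "m < n" | "n < m" by linarith
    then show "fst (f m) \<inter> fst (f n) = {}"
      by cases (use dis[of m n] dis[of n m] in auto)
  qed
  then show ?thesis by (rule that) (rule f(1))
qed

section \<open>Atoms and finite dimension\<close>

lemma indicator_Lp_fun:
  assumes "A \<in> sets M" "emeasure M A < \<infinity>"
  shows "(indicator A :: 'a \<Rightarrow> real) \<in> Lp_fun M p"
proof -
  have "(\<lambda>x. \<bar>indicator A x :: real\<bar> powr p) = indicator A"
    by (auto simp: indicator_def)
  then show ?thesis using assms by (simp add: Lp_fun_def integrable_indicator_iff)
qed

lemma Lp_fun_integrable_on: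
  assumes f: "f \<in> Lp_fun M p" and p: "1 \<le> p" and A: "A \<in> sets M" "emeasure M A < \<infinity>"
  shows "integrable M (\<lambda>x. indicator A x * f x)"
proof (rule Bochner_Integration.integrable_bound)
  have [measurable]: "f \<in> borel_measurable M" using f by (simp add: Lp_fun_def)
  note A(1)[measurable]
  show "integrable M (\<lambda>x. indicator A x + \<bar>f x\<bar> powr p)"
    using f A by (auto simp: Lp_fun_def)
  show "(\<lambda>x. indicator A x * f x) \<in> borel_measurable M" by measurable
  have "\<bar>t\<bar> \<le> 1 + \<bar>t\<bar> powr p" for t :: real
  proof (cases "\<bar>t\<bar> \<le> 1")
    case False
    then show ?thesis using p powr_mono[of 1 p "\<bar>t\<bar>"] by simp
  qed (simp add: add_increasing2)
  then show "AE x in M. norm (indicator A x * f x) \<le> norm (indicator A x + \<bar>f x\<bar> powr p)"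
    by (intro AE_I2) (simp add: indicator_def)
qed

text \<open>The part of the atom where \<open>f\<close> exceeds its mean is null or has null
  complement in the atom, so \<open>f\<close> minus the mean has one sign almost everywhere; its
  integral vanishes, and hence so does the difference.\<close>

lemma Lp_fun_const_on_atom:
  assumes f: "f \<in> Lp_fun M p" and p: "1 \<le> p" and A: "A \<in> finite_positive_sets M"
    and atom: "\<And>B. B \<in> sets M \<Longrightarrow> B \<subseteq> A \<Longrightarrow> emeasure M B = 0 \<or> emeasure M (A - B) = 0"
  shows "AE x in M. x \<in> A \<longrightarrow> f x = (\<integral>x. indicator A x * f x \<partial>M) / measure M A"
proof -
  define k where "k = (\<integral>x. indicator A x * f x \<partial>M) / measure M A"
  have [measurable]: "f \<in> borel_measurable M" "A \<in> sets M" using f A by (auto simp: Lp_fun_def finite_positive_sets_def)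
  note fin = finite_positive_sets_D[OF A]
  have i: "integrable M (\<lambda>x. indicator A x * f x)" "integrable M (\<lambda>x. k * indicator A x)"
    using Lp_fun_integrable_on[OF f p fin(1) fin(3)] fin by auto
  define g where "g x = indicator A x * f x - k * indicator A x" for x
  have gi: "integrable M g" "(\<integral>x. g x \<partial>M) = 0"
    using i fin by (auto simp: g_def[abs_def] k_def)
  have [measurable]: "g \<in> borel_measurable M" using gi by auto
  define B where "B = {x \<in> space M. x \<in> A \<and> g x > 0}"
  have B: "B \<in> sets M" "B \<subseteq> A" unfolding B_def by (measurable, auto)
  have "AE x in M. g x = 0"
  proof (cases "emeasure M B = 0")
    case True
    then have "AE x in M. x \<notin> B" using B by (intro AE_not_in) (auto simp: null_sets_def)
    then have "AE x in M. 0 \<le> - g x"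
      by (rule AE_mp[OF _ AE_I2]) (auto simp: B_def g_def indicator_def not_less split: if_splits)
    then have "AE x in M. - g x = 0"
      using integral_nonneg_eq_0_iff_AE[of M "\<lambda>x. - g x"] gi by simp
    then show ?thesis by simp
  next
    case False
    then have "emeasure M (A - B) = 0" using atom[OF B] by simp
    then have "AE x in M. x \<notin> A - B" using B fin by (intro AE_not_in) (auto simp: null_sets_def)
    then have "AE x in M. 0 \<le> g x"
      by (rule AE_mp[OF _ AE_I2]) (auto simp: B_def g_def indicator_def)
    then show ?thesis
      using integral_nonneg_eq_0_iff_AE[of M g] gi by simp
  qed
  then show ?thesis
    by (rule AE_mp) (auto intro!: AE_I2 simp: g_def k_def)
qed

text \<open>Otherwise there is a packing of largest size. Splitting a member, or adding a set
  outside the union, would enlarge it; so the members are atoms, and measurable sets of finite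
  measure outside are null. Functions in \<open>L^p\<close> are then almost everywhere constant on
  each member and 0 outside, so the indicators span.\<close>

lemma infinite_dimensional_unbounded_packing:
  assumes p: "1 \<le> p" and inf: "\<not> Lp_finite_dimensional M p"
  shows "unbounded_packing M (space M)"
proof (rule ccontr)
  define Q where "Q \<F> \<longleftrightarrow> finite \<F> \<and> \<F> \<subseteq> finite_positive_sets M \<and> disjoint \<F>" for \<F>
  assume "\<not> ?thesis"
  then obtain n where n': "\<nexists>\<F>. finite \<F> \<and> n \<le> card \<F> \<and> \<F> \<subseteq> finite_positive_sets M \<and> disjoint \<F> \<and> \<Union>\<F> \<subseteq> space M"
    unfolding unbounded_packing_def by blast
  have n: "card \<F> < n" if "Q \<F>" for \<F>
  proof (rule ccontr)
    assume "\<not> card \<F> < n"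
    moreover have "\<Union>\<F> \<subseteq> space M"
      using that by (auto simp: Q_def dest!: subsetD finite_positive_sets_D(1) dest: sets.sets_into_space)
    ultimately show False using n' that by (auto simp: Q_def not_less)
  qed
  have "Q {}" by (simp add: Q_def)
  then have "\<exists>\<F>. Q \<F> \<and> (\<forall>\<G>. Q \<G> \<longrightarrow> card \<G> \<le> card \<F>)"
    using n by (intro ex_has_greatest_nat[of Q "{}" card n]) auto
  then obtain \<F> where \<F>: "Q \<F>" and max: "\<And>\<G>. Q \<G> \<Longrightarrow> card \<G> \<le> card \<F>" by blast
  have fin: "finite \<F>" and sub: "\<F> \<subseteq> finite_positive_sets M" and dis: "disjoint \<F>" using \<F> by (auto simp: Q_def)
  have outside: "E \<notin> finite_positive_sets M" if E: "E \<inter> \<Union>\<F> = {}" for E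
  proof
    assume fE: "E \<in> finite_positive_sets M"
    then have "E \<noteq> {}" by (rule finite_positive_sets_nonempty)
    then have "E \<notin> \<F>" using E by auto
    moreover have "Q (insert E \<F>)" using fE fin sub dis E by (auto simp: Q_def disjoint_def)
    ultimately show False using max[of "insert E \<F>"] fin by simp
  qed
  have atom: "emeasure M B = 0 \<or> emeasure M (A - B) = 0" if A: "A \<in> \<F>" and B: "B \<in> sets M" "B \<subseteq> A" for A B
  proof (rule ccontr)
    assume neg: "\<not> ?thesis"
    have A': "A \<in> finite_positive_sets M" "A \<in> sets M" using A sub by (auto simp: finite_positive_sets_def)
    have BA: "B \<in> finite_positive_sets M" "A - B \<in> finite_positive_sets M"
      using neg A' B finite_positive_sets_subset[OF A'(1), of B] finite_positive_sets_subset[OF A'(1), of "A - B"]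
      by (auto simp: zero_less_iff_neq_zero)
    have meet: "G = A" if "G \<in> \<F>" "G \<subseteq> A" "G \<noteq> {}" for G
      using disjointD[OF dis that(1) A] that by blast
    \<comment> \<open>Neither half is already another member, so exchanging \<open>A\<close> for its
      two halves raises the cardinality by one.\<close>
    have new: "B \<notin> \<F> - {A}" "A - B \<notin> \<F> - {A}" "B \<noteq> A - B"
      using BA[THEN finite_positive_sets_nonempty] B meet[of B] meet[of "A - B"] by auto
    have "Q (insert B (insert (A - B) (\<F> - {A})))"
    proof -
      have away: "G \<inter> A = {}" "A \<inter> G = {}" if "G \<in> \<F> - {A}" for G
        using disjointD[OF dis, of G A] that A by auto
      have "disjoint (insert B (insert (A - B) (\<F> - {A})))"
        unfolding disjoint_def
      proof (intro ballI impI)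
        fix G H
        assume "G \<in> insert B (insert (A - B) (\<F> - {A}))" "H \<in> insert B (insert (A - B) (\<F> - {A}))" "G \<noteq> H"
        then consider "G = B" "H = A - B" | "G = A - B" "H = B"
          | "G \<subseteq> A" "H \<in> \<F> - {A}" | "H \<subseteq> A" "G \<in> \<F> - {A}"
          | "G \<in> \<F>" "H \<in> \<F>" "G \<noteq> H"
          using B(2) by blast
        then show "G \<inter> H = {}"
        proof cases
          case 3
          then show ?thesis using away(1)[of H] by blast
        next
          case 4
          then show ?thesis using away(1)[of G] by blast
        next
          case 5
          then show ?thesis by (rule disjointD[OF dis])
        qed auto
      qed
      then show ?thesis using BA fin sub by (auto simp: Q_def)
    qed
    from max[OF this] show False
      using new fin A card_gt_0_iff[of \<F>] by (auto simp: card_Diff_singleton)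
  qed
  have "Lp_finite_dimensional M p"
    unfolding Lp_finite_dimensional_def
  proof (intro exI conjI)
    let ?B = "(indicator :: 'a set \<Rightarrow> 'a \<Rightarrow> real) ` \<F>"
    show "finite ?B" using fin by simp
    show BL: "?B \<subseteq> Lp_fun M p" using sub by (auto simp: finite_positive_sets_def intro!: indicator_Lp_fun)
    show "Lp_space M p = {Lp_class M p (\<lambda>x. \<Sum>b\<in>?B. c b * b x) | c. True}"
    proof (intro equalityI subsetI)
      fix F assume "F \<in> {Lp_class M p (\<lambda>x. \<Sum>b\<in>?B. c b * b x) | c. True}"
      then show "F \<in> Lp_space M p" using Lp_fun_sum[OF p BL] by (auto intro!: Lp_class_in_space)
    next
      fix F assume "F \<in> Lp_space M p"
      then obtain f where f: "f \<in> Lp_fun M p" "F = Lp_class M p f" by (rule Lp_spaceE)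
      have [measurable]: "f \<in> borel_measurable M" using f by (simp add: Lp_fun_def)
      \<comment> \<open>Coefficients are indexed by functions, so the mean of \<open>f\<close> over
        a member is expressed through its indicator \<open>b\<close>.\<close>
      define c where "c b = (\<integral>x. b x * f x \<partial>M) / (\<integral>x. b x \<partial>M)" for b :: "'a \<Rightarrow> real"
      have inj: "inj_on (indicator :: 'a set \<Rightarrow> 'a \<Rightarrow> real) \<F>"
        by (intro inj_onI) (metis (no_types) indicator_eq_1_iff subsetI subset_antisym)
      have on: "AE x in M. \<forall>A\<in>\<F>. x \<in> A \<longrightarrow> f x = c (indicator A)"
      proof (rule AE_finite_allI[OF fin])
        fix A assume A: "A \<in> \<F>"
        then have "A \<in> finite_positive_sets M" using sub by auto
        with Lp_fun_const_on_atom[OF f(1) p this] atom[OF A]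
        show "AE x in M. x \<in> A \<longrightarrow> f x = c (indicator A)"
          by (simp add: c_def finite_positive_sets_D)
      qed
      have off: "AE x in M. x \<notin> \<Union>\<F> \<longrightarrow> f x = 0"
      proof -
        have US[measurable]: "\<Union>\<F> \<in> sets M" using fin sub by (auto simp: finite_positive_sets_def)
        have i: "integrable M (\<lambda>x. \<bar>f x\<bar> powr p)" using f by (simp add: Lp_fun_def)
        \<comment> \<open>The measure need not be sigma-finite, but by Markov's inequality the sets
          where \<bar>f\<bar> is bounded away from 0 have finite measure, and \<open>outside\<close>
          applies.\<close>
        have "AE x in M. x \<notin> {x \<in> space M. x \<notin> \<Union>\<F> \<and> 1 / (real n + 1) \<le> \<bar>f x\<bar> powr p}" for n
        proof (rule AE_not_in)
          let ?E = "{x \<in> space M. x \<notin> \<Union>\<F> \<and> 1 / (real n + 1) \<le> \<bar>f x\<bar> powr p}"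
          have E: "?E \<in> sets M" by measurable
          have "emeasure M ?E \<le> emeasure M {x \<in> space M. 1 / (real n + 1) \<le> \<bar>f x\<bar> powr p}"
            by (intro emeasure_mono) auto
          also have "\<dots> < \<infinity>"
            using integral_Markov_inequality[OF i, of "1 / (real n + 1)"] by (auto simp: le_less_trans)
          finally have "?E \<notin> finite_positive_sets M \<longrightarrow> emeasure M ?E = 0"
            using E by (auto simp: finite_positive_sets_def zero_less_iff_neq_zero)
          moreover have "?E \<notin> finite_positive_sets M" by (rule outside) auto
          ultimately show "?E \<in> null_sets M" using E by auto
        qed
        then have "AE x in M. \<forall>n. x \<notin> {x \<in> space M. x \<notin> \<Union>\<F> \<and> 1 / (real n + 1) \<le> \<bar>f x\<bar> powr p}"
          by (subst AE_all_countable) (rule allI)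
        then show ?thesis
        proof (rule AE_mp[OF _ AE_I2], intro impI)
          fix x assume x: "x \<in> space M" "\<forall>n. x \<notin> {x \<in> space M. x \<notin> \<Union>\<F> \<and> 1 / (real n + 1) \<le> \<bar>f x\<bar> powr p}"
            "x \<notin> \<Union>\<F>"
          show "f x = 0"
          proof (rule ccontr)
            assume "f x \<noteq> 0"
            then have "0 < \<bar>f x\<bar> powr p" by simp
            from reals_Archimedean[OF this] obtain n where "inverse (real (Suc n)) < \<bar>f x\<bar> powr p" by auto
            then show False using x by (auto simp: inverse_eq_divide add.commute intro: less_imp_le)
          qed
        qed
      qed
      have "AE x in M. f x = (\<Sum>b\<in>?B. c b * b x)"
        using on off
      proof eventually_elim
        case (elim x)
        have "(\<Sum>b\<in>?B. c b * b x) = (\<Sum>A\<in>\<F>. c (indicator A) * indicator A x)"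
          using inj by (simp add: sum.reindex)
        also have "\<dots> = f x"
        proof (cases "x \<in> \<Union>\<F>")
          case True
          then obtain A where A: "A \<in> \<F>" "x \<in> A" by auto
          have "(\<Sum>A\<in>\<F>. c (indicator A) * indicator A x) = (\<Sum>B\<in>{A}. c (indicator B) * indicator B x)"
            using A fin dis by (intro sum.mono_neutral_right) (auto simp: disjoint_def indicator_def)
          then show ?thesis using elim A by simp
        next
          case False
          then have "(\<Sum>A\<in>\<F>. c (indicator A) * indicator A x) = 0"
            by (intro sum.neutral) auto
          then show ?thesis using elim False by simp
        qed
        finally show ?case by simp
      qed
      then have "(f, \<lambda>x. \<Sum>b\<in>?B. c b * b x) \<in> Lp_rel M p"
        using f Lp_fun_sum[OF p BL, of c] by (simp add: Lp_rel_def)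
      then have "F = Lp_class M p (\<lambda>x. \<Sum>b\<in>?B. c b * b x)"
        unfolding f(2) Lp_class_def by (rule equiv_class_eq[OF equiv_Lp_rel])
      then show "F \<in> {Lp_class M p (\<lambda>x. \<Sum>b\<in>?B. c b * b x) | c. True}" by blast
    qed
  qed
  with inf show False by simp
qed

section \<open>Disjointly supported moves in \<open>L\<^sup>p\<close>\<close>

definition bump :: "'a measure \<Rightarrow> real \<Rightarrow> 'a set \<Rightarrow> 'a \<Rightarrow> real" where
  "bump M p A x = indicator A x * (1 / measure M A powr (1 / p))"

lemma bump_Lp_fun: "A \<in> finite_positive_sets M \<Longrightarrow> bump M p A \<in> Lp_fun M p"
  using Lp_fun_scale[OF indicator_Lp_fun[of A M p], of "1 / measure M A powr (1 / p)"] finite_positive_sets_D[of A M]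
  by (simp add: bump_def[abs_def] mult.commute)

lemma Lp_norm_bump:
  assumes "1 \<le> p" "A \<in> finite_positive_sets M"
  shows "Lp_norm M p (bump M p A) = 1"
proof -
  have "(\<lambda>x. \<bar>bump M p A x\<bar> powr p) = (\<lambda>x. indicator A x * (1 / measure M A))"
    using assms by (auto simp: bump_def indicator_def powr_divide powr_powr)
  then show ?thesis
    using finite_positive_sets_D[OF assms(2)] by (simp add: Lp_norm_def)
qed

text \<open>The sets are disjoint, so by dominated convergence the part of \<open>h\<close> on
  \<open>A j\<close> tends to 0 in norm. The integral splits exactly into the part off
  \<open>A j\<close>, where only \<open>h\<close> contributes, and the part on \<open>A j\<close>,
  where the function differs from the scaled bump by \<open>hA j\<close>.\<close>

lemma bump_asymptotically_orthogonal:
  assumes p: "1 \<le> p" and A: "disjoint_family A" "\<And>j. A j \<in> finite_positive_sets M"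
    and h: "h \<in> Lp_fun M p" and a: "0 < a"
  shows "(\<lambda>j::nat. Lp_norm M p (\<lambda>x. h x + a * bump M p (A j) x) powr p)
    \<longlonglongrightarrow> Lp_norm M p h powr p + a powr p"
proof -
  have [measurable]: "h \<in> borel_measurable M" "\<And>j. A j \<in> sets M"
    using h finite_positive_sets_D(1)[OF A(2)] by (auto simp: Lp_fun_def)
  have i: "integrable M (\<lambda>x. \<bar>h x\<bar> powr p)" using h by (simp add: Lp_fun_def)
  define hA where "hA j x = indicator (A j) x * h x" for j x
  have hA: "hA j \<in> Lp_fun M p" for j
    unfolding Lp_fun_def
  proof (intro CollectI conjI)
    show "hA j \<in> borel_measurable M" unfolding hA_def[abs_def] by measurable
    then show "integrable M (\<lambda>x. \<bar>hA j x\<bar> powr p)"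
      by (intro Bochner_Integration.integrable_bound[OF i]) (auto simp: hA_def indicator_def)
  qed
  have "(\<lambda>j. \<integral>x. \<bar>hA j x\<bar> powr p \<partial>M) \<longlonglongrightarrow> (\<integral>x. 0 \<partial>M)"
  proof (rule integral_dominated_convergence)
    show "integrable M (\<lambda>x. \<bar>h x\<bar> powr p)" by (rule i)
    show "AE x in M. (\<lambda>j. \<bar>hA j x\<bar> powr p) \<longlonglongrightarrow> 0"
    proof (rule AE_I2)
      fix x
      have "\<forall>\<^sub>F j in sequentially. x \<notin> A j"
      proof (cases "\<exists>j. x \<in> A j")
        case True
        then obtain j0 where "x \<in> A j0" ..
        then have "x \<notin> A j" if "Suc j0 \<le> j" for j
          using disjoint_family_onD[OF A(1), of j0 j] that \<open>x \<in> A j0\<close> by auto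
        then show ?thesis by (intro eventually_sequentiallyI[of "Suc j0"]) blast
      qed simp
      then have "\<forall>\<^sub>F j in sequentially. \<bar>hA j x\<bar> powr p = 0"
        by eventually_elim (simp add: hA_def)
      then show "(\<lambda>j. \<bar>hA j x\<bar> powr p) \<longlonglongrightarrow> 0" by (rule tendsto_eventually)
    qed
    show "AE x in M. norm (\<bar>hA j x\<bar> powr p) \<le> \<bar>h x\<bar> powr p" for j
      by (auto simp: hA_def indicator_def)
  qed (auto simp: hA_def)
  then have I: "(\<lambda>j. Lp_norm M p (hA j) powr p) \<longlonglongrightarrow> 0"
    using p by (simp add: Lp_norm_powr)
  then have "(\<lambda>j. (Lp_norm M p (hA j) powr p) powr (1 / p)) \<longlonglongrightarrow> 0 powr (1 / p)"
    using p by (intro tendsto_powr') auto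
  then have N0: "(\<lambda>j. Lp_norm M p (hA j)) \<longlonglongrightarrow> 0"
    using p by (simp add: powr_powr)
  have b: "(\<lambda>x. a * bump M p (A j) x) \<in> Lp_fun M p" "Lp_norm M p (\<lambda>x. a * bump M p (A j) x) = a" for j
    using p a A(2) Lp_norm_scale[of p M a "bump M p (A j)"] Lp_norm_bump[of p "A j" M]
    by (auto intro: Lp_fun_scale bump_Lp_fun)
  \<comment> \<open>This is the restriction of \<open>h\<close> plus the scaled bump to
    \<open>A j\<close>.\<close>
  define s where "s j x = hA j x + a * bump M p (A j) x" for j x
  have s: "s j \<in> Lp_fun M p" for j unfolding s_def[abs_def] by (rule Lp_fun_add[OF p hA b(1)])
  have "\<bar>Lp_norm M p (s j) - a\<bar> \<le> Lp_norm M p (hA j)" for j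
  proof -
    have "Lp_norm M p (s j) \<le> Lp_norm M p (hA j) + a"
      unfolding s_def[abs_def] using Lp_norm_triangle[OF p hA b(1), of j j] b(2)[of j] by simp
    moreover have "a \<le> Lp_norm M p (s j) + Lp_norm M p (hA j)"
    proof -
      have "a = Lp_norm M p (\<lambda>x. s j x + - hA j x)" using b(2)[of j] by (simp add: s_def)
      also have "\<dots> \<le> Lp_norm M p (s j) + Lp_norm M p (\<lambda>x. - hA j x)"
        using Lp_fun_scale[OF hA, of "-1" j] by (intro Lp_norm_triangle[OF p s]) simp
      also have "Lp_norm M p (\<lambda>x. - hA j x) = Lp_norm M p (hA j)" by (rule Lp_norm_uminus)
      finally show ?thesis .
    qed
    ultimately show ?thesis by linarith
  qed
  then have "(\<lambda>j. Lp_norm M p (s j) - a) \<longlonglongrightarrow> 0"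
    by (intro Lim_null_comparison[OF _ N0]) (simp add: always_eventually)
  then have "(\<lambda>j. Lp_norm M p (s j)) \<longlonglongrightarrow> a" by (simp add: LIM_zero_iff)
  then have "(\<lambda>j. Lp_norm M p (s j) powr p) \<longlonglongrightarrow> a powr p"
    using a by (intro tendsto_powr) auto
  from tendsto_add[OF tendsto_diff[OF tendsto_const I] this]
  have "(\<lambda>j. Lp_norm M p h powr p - Lp_norm M p (hA j) powr p + Lp_norm M p (s j) powr p)
      \<longlonglongrightarrow> Lp_norm M p h powr p + a powr p"
    by simp
  moreover have "Lp_norm M p (\<lambda>x. h x + a * bump M p (A j) x) powr p
      = Lp_norm M p h powr p - Lp_norm M p (hA j) powr p + Lp_norm M p (s j) powr p" for j
  proof -
    have "(\<integral>x. \<bar>h x + a * bump M p (A j) x\<bar> powr p \<partial>M)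
        = (\<integral>x. \<bar>h x\<bar> powr p - \<bar>hA j x\<bar> powr p + \<bar>s j x\<bar> powr p \<partial>M)"
      by (intro Bochner_Integration.integral_cong) (auto simp: hA_def s_def bump_def indicator_def)
    also have "\<dots> = (\<integral>x. \<bar>h x\<bar> powr p \<partial>M) - (\<integral>x. \<bar>hA j x\<bar> powr p \<partial>M) + (\<integral>x. \<bar>s j x\<bar> powr p \<partial>M)"
      using i hA[of j] s[of j] by (simp add: Lp_fun_def)
    finally show ?thesis using p by (simp add: Lp_norm_powr)
  qed
  ultimately show ?thesis by simp
qed

section \<open>Far moves and flatness on classes\<close>

text \<open>Moves add a bump to this representative; the class obtained does not depend on the
  choice.\<close>

definition Lp_rep :: "('a \<Rightarrow> real) set \<Rightarrow> 'a \<Rightarrow> real" where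
  "Lp_rep F = (SOME f. f \<in> F)"

lemma Lp_rep:
  assumes "F \<in> Lp_space M p"
  shows "Lp_rep F \<in> Lp_fun M p" "Lp_class M p (Lp_rep F) = F"
proof -
  obtain f where f: "f \<in> Lp_fun M p" "F = Lp_class M p f" using assms by (rule Lp_spaceE)
  then have "f \<in> F" by (simp add: Lp_class_def Lp_rel_def)
  then have "Lp_rep F \<in> F" unfolding Lp_rep_def by (rule someI[of "\<lambda>f. f \<in> F"])
  then have r: "(f, Lp_rep F) \<in> Lp_rel M p" using f by (simp add: Lp_class_def)
  then show "Lp_rep F \<in> Lp_fun M p" by (simp add: Lp_rel_def)
  show "Lp_class M p (Lp_rep F) = F"
    using equiv_class_eq[OF equiv_Lp_rel r] f by (simp add: Lp_class_def)
qed

lemma far_metric_Lp: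
  assumes p: "1 < p" and A: "disjoint_family A" "\<And>j. A j \<in> finite_positive_sets M"
  shows "far_metric (Lp_space M p) (Lp_dist M p) p
    (\<lambda>j a F. Lp_class M p (\<lambda>x. Lp_rep F x + a * bump M p (A j) x))"
proof -
  have p1: "1 \<le> p" using p by simp
  interpret Metric_space "Lp_space M p" "Lp_dist M p" by (rule Metric_space_Lp[OF p1])
  have T: "(\<lambda>x. Lp_rep F x + a * bump M p (A j) x) \<in> Lp_fun M p" if "F \<in> Lp_space M p" for F a j
    by (intro Lp_fun_add[OF p1] Lp_rep[OF that] Lp_fun_scale bump_Lp_fun A)
  have dist: "Lp_dist M p (Lp_class M p f) G = Lp_norm M p (\<lambda>x. f x - Lp_rep G x)"
    if "f \<in> Lp_fun M p" "G \<in> Lp_space M p" for f G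
    using Lp_dist_class[OF p1 that(1) Lp_rep(1)[OF that(2)]] Lp_rep(2)[OF that(2)] by simp
  have dist': "Lp_dist M p F G = Lp_norm M p (\<lambda>x. Lp_rep F x - Lp_rep G x)"
    if "F \<in> Lp_space M p" "G \<in> Lp_space M p" for F G
    using dist[OF Lp_rep(1)[OF that(1)] that(2)] Lp_rep(2)[OF that(1)] by simp
  show ?thesis
  proof
    show "1 \<le> p" by (rule p1)
    show mcomplete by (rule Lp_mcomplete[OF p1])
    fix F j a
    assume F: "F \<in> Lp_space M p"
    then show "Lp_class M p (\<lambda>x. Lp_rep F x + a * bump M p (A j) x) \<in> Lp_space M p"
      by (intro Lp_class_in_space T)
    fix G
    assume G: "G \<in> Lp_space M p"
    have "Lp_dist M p (Lp_class M p (\<lambda>x. Lp_rep F x + a * bump M p (A j) x))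
          (Lp_class M p (\<lambda>x. Lp_rep G x + a * bump M p (A j) x))
        = Lp_norm M p (\<lambda>x. (Lp_rep F x + a * bump M p (A j) x) - (Lp_rep G x + a * bump M p (A j) x))"
      by (rule Lp_dist_class[OF p1 T[OF F] T[OF G]])
    then show "Lp_dist M p (Lp_class M p (\<lambda>x. Lp_rep F x + a * bump M p (A j) x))
          (Lp_class M p (\<lambda>x. Lp_rep G x + a * bump M p (A j) x)) = Lp_dist M p F G"
      by (simp add: dist'[OF F G])
  next
    fix F G a assume F: "F \<in> Lp_space M p" and G: "G \<in> Lp_space M p" and a: "0 < (a::real)"
    have "Lp_dist M p (Lp_class M p (\<lambda>x. Lp_rep F x + a * bump M p (A j) x)) G
        = Lp_norm M p (\<lambda>x. (Lp_rep F x - Lp_rep G x) + a * bump M p (A j) x)" for j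
      by (subst dist[OF T[OF F] G]) (simp add: algebra_simps)
    then show "(\<lambda>j. Lp_dist M p (Lp_class M p (\<lambda>x. Lp_rep F x + a * bump M p (A j) x)) G powr p)
        \<longlonglongrightarrow> Lp_dist M p F G powr p + a powr p"
      using bump_asymptotically_orthogonal[OF p1 A Lp_fun_diff[OF p1 Lp_rep(1)[OF F] Lp_rep(1)[OF G]] a]
      by (simp add: dist'[OF F G])
  next
    fix F F' and e :: real assume F: "F \<in> Lp_space M p" and F': "F' \<in> Lp_space M p" and e: "0 < e"
    \<comment> \<open>With \<open>f''\<close> below, the reflection of \<open>F'\<close> in
      \<open>F\<close>, the differences \<open>F' - C\<close> and \<open>f'' - C\<close> become
      \<open>F - C\<close> plus and minus \<open>g\<close>.\<close>
    define g where "g x = Lp_rep F' x - Lp_rep F x" for x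
    have g: "g \<in> Lp_fun M p" unfolding g_def[abs_def] by (intro Lp_fun_diff[OF p1] Lp_rep F F')
    define f'' where "f'' x = Lp_rep F x - g x" for x
    have f'': "f'' \<in> Lp_fun M p" unfolding f''_def[abs_def] by (intro Lp_fun_diff[OF p1] Lp_rep(1)[OF F] g)
    obtain K where K: "\<And>f. f \<in> Lp_fun M p \<Longrightarrow> K \<le> Lp_norm M p f \<Longrightarrow>
        Lp_norm M p (\<lambda>x. f x + g x) + Lp_norm M p (\<lambda>x. f x - g x) \<le> 2 * Lp_norm M p f + e"
      using Lp_norm_flat[OF p g e] by metis
    have "Lp_dist M p F' C + Lp_dist M p (Lp_class M p f'') C \<le> 2 * Lp_dist M p F C + e"
      if C: "C \<in> Lp_space M p" "K \<le> Lp_dist M p F C" for C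
      using K[of "\<lambda>x. Lp_rep F x - Lp_rep C x"] Lp_fun_diff[OF p1 Lp_rep(1)[OF F] Lp_rep(1)[OF C(1)]] C(2)
      by (simp add: dist'[OF F C(1)] dist'[OF F' C(1)] dist[OF f'' C(1)] f''_def g_def algebra_simps)
    then show "\<exists>F''\<in>Lp_space M p. \<exists>K. \<forall>C\<in>Lp_space M p. K \<le> Lp_dist M p F C \<longrightarrow>
        Lp_dist M p F' C + Lp_dist M p F'' C \<le> 2 * Lp_dist M p F C + e"
      using Lp_class_in_space[OF f''] by blast
  next
    fix F C and r e :: real
    assume F: "F \<in> Lp_space M p" and C: "C \<in> Lp_space M p" and r: "0 < r" "r \<le> Lp_dist M p F C" and e: "0 < e"
    define D where "D = Lp_dist M p F C"
    have D: "D = Lp_norm M p (\<lambda>x. Lp_rep C x - Lp_rep F x)"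
      unfolding D_def dist'[OF F C] by (rule Lp_norm_minus_commute)
    \<comment> \<open>The point \<open>z\<close> below lies on the segment from \<open>F\<close> to
      \<open>C\<close>, at distance \<open>r - m\<close> from \<open>C\<close> and
      \<open>D - r + m\<close> from \<open>F\<close>; \<open>m < r\<close> keeps it on the
      segment.\<close>
    define m where "m = min e r / 2"
    define t where "t = (D - r + m) / D"
    have D0: "0 < D" "r \<le> D" using r by (auto simp: D_def)
    have m: "0 < m" "m < r" "m < e" using e r by (auto simp: m_def)
    have t: "0 \<le> t" "t \<le> 1" "t * D = D - r + m" using D0 m by (auto simp: t_def)
    define z where "z x = Lp_rep F x + t * (Lp_rep C x - Lp_rep F x)" for x
    have z: "z \<in> Lp_fun M p"
      unfolding z_def[abs_def] by (intro Lp_fun_add[OF p1] Lp_fun_scale Lp_fun_diff[OF p1] Lp_rep F C)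
    have "Lp_dist M p (Lp_class M p z) C = Lp_norm M p (\<lambda>x. (1 - t) * (Lp_rep F x - Lp_rep C x))"
      by (subst dist[OF z C]) (simp add: z_def algebra_simps)
    also have "\<dots> = (1 - t) * D"
      using t p by (subst Lp_norm_scale) (auto simp: D_def dist'[OF F C])
    also have "\<dots> < r" using t m by (simp add: algebra_simps)
    finally have 1: "Lp_dist M p (Lp_class M p z) C < r" .
    have "Lp_dist M p F (Lp_class M p z) = Lp_dist M p (Lp_class M p z) F" by (rule commute)
    also have "\<dots> = Lp_norm M p (\<lambda>x. t * (Lp_rep C x - Lp_rep F x))"
      by (subst dist[OF z F]) (simp add: z_def)
    also have "\<dots> = t * D"
      using t p by (subst Lp_norm_scale) (auto simp: D)
    also have "\<dots> < Lp_dist M p F C - r + e" using t m by (simp add: D_def)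
    finally show "\<exists>z\<in>Lp_space M p. Lp_dist M p z C < r \<and> Lp_dist M p F z < Lp_dist M p F C - r + e"
      using 1 Lp_class_in_space[OF z] by blast
  qed
qed

section \<open>Countability and conclusion\<close>

text \<open>A ball of positive radius contains a point of a countable dense set, and each such point
  lies in only finitely many members.\<close>

lemma (in Metric_space) countable_point_finite_cballs:
  assumes sep: "separable_space mtopology"
    and ball: "\<And>B. B \<in> \<B> \<Longrightarrow> \<exists>x\<in>M. \<exists>r>0. B = mcball x r"
    and fin: "point_finite_on M \<B>"
  shows "countable \<B>"
proof -
  obtain D where D: "countable D" "D \<subseteq> M" "mtopology closure_of D = M"
    using sep by (auto simp: separable_space_def)
  have "\<B> \<subseteq> (\<Union>x\<in>D. {B \<in> \<B>. x \<in> B})"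
  proof
    fix B assume B: "B \<in> \<B>"
    then obtain x r where x: "x \<in> M" "0 < r" "B = mcball x r" using ball by blast
    then have "x \<in> mtopology closure_of D" using D(3) by simp
    then obtain y where "y \<in> D" "y \<in> mball x r"
      using x(2) unfolding metric_closure_of by blast
    then show "B \<in> (\<Union>x\<in>D. {B \<in> \<B>. x \<in> B})" using B x by auto
  qed
  moreover have "countable (\<Union>x\<in>D. {B \<in> \<B>. x \<in> B})"
    using D fin by (intro countable_UN) (auto simp: point_finite_on_def intro!: countable_finite)
  ultimately show ?thesis by (rule countable_subset)
qed

theorem corollary1p6:
  fixes M :: "'a measure" and p :: real and \<B> :: "('a \<Rightarrow> real) set set set"
  assumes "1 < p"
    and "separable_space (Lp_topology M p)"
    and "\<not> Lp_finite_dimensional M p"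
    and "\<And>B. B \<in> \<B> \<Longrightarrow> \<exists>F\<in>Lp_space M p. \<exists>r>0. B = Lp_cball M p F r"
    and "\<And>F. F \<in> Lp_space M p \<Longrightarrow> \<exists>B\<in>\<B>. F \<in> B"
  shows "\<not> point_finite_on (Lp_space M p) \<B>"
proof
  assume fin: "point_finite_on (Lp_space M p) \<B>"
  have p: "1 \<le> p" using assms(1) by simp
  interpret Metric_space "Lp_space M p" "Lp_dist M p" by (rule Metric_space_Lp[OF p])
  obtain A :: "nat \<Rightarrow> 'a set" where A: "disjoint_family A" "\<And>j. A j \<in> finite_positive_sets M"
    using unbounded_packing_disjoint_sequence[OF infinite_dimensional_unbounded_packing[OF p assms(3)]]
    by metis
  obtain c r where cr: "\<And>B. B \<in> \<B> \<Longrightarrow> c B \<in> Lp_space M p \<and> 0 < r B \<and> B = mcball (c B) (r B)"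
    using assms(4) by metis
  have mem: "B \<in> \<B> \<Longrightarrow> F \<in> Lp_space M p \<Longrightarrow> F \<in> B \<longleftrightarrow> Lp_dist M p (c B) F \<le> r B" for B F
    using cr[of B] by (metis in_mcball)
  interpret ball_cover "Lp_space M p" "Lp_dist M p" p
    "\<lambda>j a F. Lp_class M p (\<lambda>x. Lp_rep F x + a * bump M p (A j) x)" \<B> c r
  proof (rule ball_cover.intro[OF far_metric_Lp[OF assms(1) A]], unfold_locales)
    show "countable \<B>"
      by (rule countable_point_finite_cballs[OF assms(2,4) fin])
    fix F assume F: "F \<in> Lp_space M p"
    then show "\<exists>B\<in>\<B>. Lp_dist M p (c B) F \<le> r B" using assms(5)[OF F] mem by blast
    have "{B \<in> \<B>. Lp_dist M p (c B) F \<le> r B} = {B \<in> \<B>. F \<in> B}" using mem F by blast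
    then show "finite {B \<in> \<B>. Lp_dist M p (c B) F \<le> r B}"
      using fin F by (simp add: point_finite_on_def)
  qed (use cr in blast)+
  \<comment> \<open>The zero class shows that the space is nonempty, against
    \<open>point_finite_cover_imp_empty\<close>.\<close>
  have "Lp_class M p (\<lambda>x. 0) \<in> Lp_space M p"
    by (intro Lp_class_in_space) (simp add: Lp_fun_def)
  with point_finite_cover_imp_empty show False by simp
qed

end
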